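(* Let $X\subset\mathbb{C}^2$ be a reduced algebraic curve, let $\xi\in X^\infty\cap Q^\infty$, and let $\Gamma$ be a branch of $\overline X$ at $\xi$. Then: (a) $u\in\Delta^{\mathrm{atyp}}_\xi(\Gamma)$ if and only if $\operatorname{ord}_t h(t,u)\ge1+\operatorname{mult}_\xi(\Gamma,H^\infty)$. (b) If $\Delta^{\mathrm{atyp}}_\xi(\Gamma)\neq\emptyset$, then $\Delta^{\mathrm{atyp}}_\xi(\Gamma)$ is the line $\{u\in\mathbb{C}^2\mid h_k(u)=0\}$. In particular, $\Delta^{\mathrm{atyp}}$ is a finite union of isotropic lines.
   Context: $\overline X\subset\mathbb{P}^2$ is the projective closure of $X$, $H^\infty$ the line at infinity, $X^\infty=\overline X\cap H^\infty$, and $Q^\infty=\{x^2+y^2=0\}\subset H^\infty$, i.e. the two isotropic points $[1;i]$ and $[i;1]$. A line in $\mathbb{C}^2$ is isotropic if its projective closure contains a point of $Q^\infty$. $\operatorname{mult}_\xi(\Gamma,H^\infty)$ is the intersection multiplicity of $\Gamma$ with $H^\infty$ at $\xi$. For $\xi\in X^\infty$ and a local branch $\Gamma$ of $\overline X$ at $\xi$, $\Delta^{\mathrm{atyp}}_\xi(\Gamma)$ is the set of $u\in\mathbb{C}^2$ such that there are sequences $u_n\to u$ in $\mathbb{C}^2$ and $\mathbf{x}_n\in\Gamma\setminus H^\infty$, $\mathbf{x}_n\to\xi$, with $\langle u_n-\mathbf{x}_n,v\rangle=0$ for all $v\in T_{\mathbf{x}_n}X_{\mathrm{reg}}$, where $\langle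 a,b\rangle=a_1b_1+a_2b_2$. $\Delta^{\mathrm{atyp}}$ is the union of $\Delta^{\mathrm{atyp}}_\xi(\Gamma)$ over all $\xi\in X^\infty$ and all local branches $\Gamma$ of $\overline X$ at $\xi$. Let $\gamma:B\to\Gamma$ be a local holomorphic parametrization of the branch, $B\subset\mathbb{C}$ a small disk centred at $0$, $\gamma(0)=\xi$. In the affine coordinates of $\mathbb{C}^2$ write $x(t)=P(t)/t^k$, $y(t)=Q(t)/t^k$ with $P,Q$ holomorphic and $P(0),Q(0)$ not both zero, $k\ge1$. For $u=(u_1,u_2)$ define $$h(t,u)=\bigl(tP'(t)-kP(t)\bigr)\bigl(P(t)-u_1t^k\bigr)+\bigl(tQ'(t)-kQ(t)\bigr)\bigl(Q(t)-u_2t^k\bigr)=\sum_{j\ge0}h_j(u)t^j.$$ *)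

theory Defs
  imports "HOL-Complex_Analysis.Complex_Analysis" "HOL-Computational_Algebra.Squarefree"
begin

(* A bivariate polynomial is a polynomial in y whose coefficients are polynomials in x. *)
definition eval2 :: "complex poly poly \<Rightarrow> complex \<times> complex \<Rightarrow> complex" where
  "eval2 f p = poly (poly f [:snd p:]) (fst p)"

definition dx :: "complex poly poly \<Rightarrow> complex poly poly" where
  "dx f = map_poly pderiv f"

definition dy :: "complex poly poly \<Rightarrow> complex poly poly" where
  "dy f = pderiv f"

(* f is a reduced equation of a curve: the units of C[x,y] are the nonzero constants, and
   squarefree f excludes f = 0. *)
definition reduced_curve :: "complex poly poly \<Rightarrow> bool" where
  "reduced_curve f \<longleftrightarrow> squarefree f \<and> \<not> is_unit f"

definition curve :: "complex poly poly \<Rightarrow> (complex \<times> complex) set" where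
  "curve f = {p. eval2 f p = 0}"

(* Jacobian criterion; it describes the regular part because f is squarefree. *)
definition curve_reg :: "complex poly poly \<Rightarrow> (complex \<times> complex) set" where
  "curve_reg f = {p \<in> curve f. (eval2 (dx f) p, eval2 (dy f) p) \<noteq> (0, 0)}"

definition tangent :: "complex poly poly \<Rightarrow> complex \<times> complex \<Rightarrow> (complex \<times> complex) set" where
  "tangent f p = {v. eval2 (dx f) p * fst v + eval2 (dy f) p * snd v = 0}"

(* The complex bilinear (not Hermitian) form. *)
definition bil :: "complex \<times> complex \<Rightarrow> complex \<times> complex \<Rightarrow> complex" where
  "bil a b = fst a * fst b + snd a * snd b"

definition proj_rel :: "complex ^ 3 \<Rightarrow> complex ^ 3 \<Rightarrow> bool" where
  "proj_rel v w \<longleftrightarrow> v \<noteq> 0 \<and> w \<noteq> 0 \<and> (\<exists>c. c \<noteq> 0 \<and> w = c *s v)"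

lemma part_equivp_proj_rel: "part_equivp proj_rel"
proof (rule part_equivpI)
  have "(axis 1 1 :: complex ^ 3) \<noteq> 0"
    by (simp add: axis_eq_0_iff)
  moreover have "(axis 1 1 :: complex ^ 3) = 1 *s axis 1 1"
    by (simp only: vector_smult_lid)
  ultimately have "proj_rel (axis 1 1) (axis 1 1)"
    unfolding proj_rel_def using one_neq_zero by blast
  then show "\<exists>v. proj_rel v v"
    by (rule exI)
  show "symp proj_rel"
  proof (rule sympI)
    fix v w assume "proj_rel v w"
    then obtain c where c: "v \<noteq> 0" "w \<noteq> 0" "c \<noteq> 0" "w = c *s v"
      unfolding proj_rel_def by blast
    have "v = inverse c *s w"
      by (simp only: c(4) vector_smult_assoc left_inverse[OF c(3)] vector_smult_lid)
    moreover have "inverse c \<noteq> 0"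
      using c(3) by simp
    ultimately show "proj_rel w v"
      unfolding proj_rel_def using c(1,2) by blast
  qed
  show "transp proj_rel"
  proof (rule transpI)
    fix u v w assume "proj_rel u v" "proj_rel v w"
    then obtain c d where c: "u \<noteq> 0" "w \<noteq> 0" "c \<noteq> 0" "d \<noteq> 0" "v = c *s u" "w = d *s v"
      unfolding proj_rel_def by blast
    have "w = (d * c) *s u"
      by (simp only: c(5,6) vector_smult_assoc)
    moreover have "d * c \<noteq> 0"
      using c(3,4) by simp
    ultimately show "proj_rel u w"
      unfolding proj_rel_def using c(1,2) by blast
  qed
qed

quotient_type P2 = "complex ^ 3" / partial: proj_rel
  by (rule part_equivp_proj_rel)

(* The point with homogeneous coordinates v; only meaningful for v \<noteq> 0. *)
definition proj :: "complex ^ 3 \<Rightarrow> P2" where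
  "proj v = abs_P2 v"

(* The quotient topology of C^3 - {0}. *)
instantiation P2 :: topological_space
begin

definition open_P2 :: "P2 set \<Rightarrow> bool" where
  "open_P2 U \<longleftrightarrow> open {v. v \<noteq> 0 \<and> proj v \<in> U}"

instance
proof
  have "{v. v \<noteq> (0 :: complex ^ 3) \<and> proj v \<in> UNIV} = - {0}"
    by blast
  then show "open (UNIV :: P2 set)"
    unfolding open_P2_def by (simp only: open_Compl closed_singleton)
next
  fix S T :: "P2 set"
  assume ST: "open S" "open T"
  have "{v. v \<noteq> 0 \<and> proj v \<in> S \<inter> T} = {v. v \<noteq> 0 \<and> proj v \<in> S} \<inter> {v. v \<noteq> 0 \<and> proj v \<in> T}"
    by blast
  then show "open (S \<inter> T)"
    using ST unfolding open_P2_def by (simp only: open_Int)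
next
  fix K :: "P2 set set"
  assume K: "\<forall>S\<in>K. open S"
  have "{v. v \<noteq> 0 \<and> proj v \<in> \<Union>K} = (\<Union>S\<in>K. {v. v \<noteq> 0 \<and> proj v \<in> S})"
    by blast
  moreover have "open (\<Union>S\<in>K. {v. v \<noteq> 0 \<and> proj v \<in> S})"
    using K unfolding open_P2_def by (intro open_UN) blast
  ultimately show "open (\<Union>K)"
    unfolding open_P2_def by (simp only:)
qed

end

definition affine_pt :: "complex \<times> complex \<Rightarrow> P2" where
  "affine_pt p = proj (vector [fst p, snd p, 1])"

definition H_inf :: "P2 set" where
  "H_inf = {proj (vector [x, y, 0]) | x y. (x, y) \<noteq> (0, 0)}"

definition Q_inf :: "P2 set" where
  "Q_inf = {proj (vector [x, y, 0]) | x y. (x, y) \<noteq> (0, 0) \<and> x^2 + y^2 = 0}"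

(* For an algebraic subset of C^2 the closure in the classical topology is also the Zariski
   closure. *)
definition proj_closure :: "(complex \<times> complex) set \<Rightarrow> P2 set" where
  "proj_closure S = closure (affine_pt ` S)"

definition X_inf :: "complex poly poly \<Rightarrow> P2 set" where
  "X_inf f = proj_closure (curve f) \<inter> H_inf"

definition is_line :: "(complex \<times> complex) set \<Rightarrow> bool" where
  "is_line L \<longleftrightarrow> (\<exists>a b c. (a, b) \<noteq> (0, 0) \<and> L = {(x, y). a * x + b * y = c})"

definition isotropic_line :: "(complex \<times> complex) set \<Rightarrow> bool" where
  "isotropic_line L \<longleftrightarrow> is_line L \<and> proj_closure L \<inter> Q_inf \<noteq> {}"

definition holomorphic_lift :: "(complex \<Rightarrow> complex ^ 3) \<Rightarrow> complex set \<Rightarrow> (complex \<Rightarrow> P2) \<Rightarrow> bool" where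
  "holomorphic_lift F U \<gamma> \<longleftrightarrow>
     (\<forall>i. (\<lambda>t. F t $ i) holomorphic_on U) \<and> (\<forall>t\<in>U. F t \<noteq> 0 \<and> \<gamma> t = proj (F t))"

definition holomorphic_P2 :: "(complex \<Rightarrow> P2) \<Rightarrow> complex set \<Rightarrow> bool" where
  "holomorphic_P2 \<gamma> S \<longleftrightarrow>
     (\<forall>t\<in>S. \<exists>U F. open U \<and> t \<in> U \<and> U \<subseteq> S \<and> holomorphic_lift F U \<gamma>)"

(* A branch is a germ at \<xi>, represented here by any set \<Gamma> having that germ. A parametrization
   maps the disk of radius r homeomorphically onto a neighbourhood of \<xi> in \<Gamma>; being a
   homeomorphism makes it primitive and keeps \<gamma> t away from \<xi> when t approaches the
   boundary of the disk. *)
definition branch_param :: "P2 \<Rightarrow> P2 set \<Rightarrow> (complex \<Rightarrow> P2) \<Rightarrow> real \<Rightarrow> bool" where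
  "branch_param \<xi> \<Gamma> \<gamma> r \<longleftrightarrow>
     0 < r \<and> holomorphic_P2 \<gamma> (ball 0 r) \<and> \<gamma> 0 = \<xi> \<and>
     (\<exists>\<delta>. homeomorphism (ball 0 r) (\<gamma> ` ball 0 r) \<gamma> \<delta>) \<and>
     openin (top_of_set \<Gamma>) (\<gamma> ` ball 0 r)"

definition is_branch :: "complex poly poly \<Rightarrow> P2 \<Rightarrow> P2 set \<Rightarrow> bool" where
  "is_branch f \<xi> \<Gamma> \<longleftrightarrow>
     \<Gamma> \<subseteq> proj_closure (curve f) \<and> (\<exists>\<gamma> r. branch_param \<xi> \<Gamma> \<gamma> r)"

(* The order in t at 0 of a function that is holomorphic near 0. *)
definition ord_t :: "(complex \<Rightarrow> complex) \<Rightarrow> enat" where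
  "ord_t g = (if fps_expansion g 0 = 0 then \<infinity> else enat (subdegree (fps_expansion g 0)))"

(* The intersection multiplicity at \<xi> of the branch with the line at infinity: the order of
   the equation z = 0 of this line along a (primitive) parametrization. *)
definition mult_inf :: "P2 \<Rightarrow> P2 set \<Rightarrow> enat" where
  "mult_inf \<xi> \<Gamma> =
     (THE m. \<exists>\<gamma> r F U. branch_param \<xi> \<Gamma> \<gamma> r \<and> open U \<and> 0 \<in> U \<and> U \<subseteq> ball 0 r \<and>
        holomorphic_lift F U \<gamma> \<and> m = ord_t (\<lambda>t. F t $ 3))"

definition atyp_branch :: "complex poly poly \<Rightarrow> P2 \<Rightarrow> P2 set \<Rightarrow> (complex \<times> complex) set" where
  "atyp_branch f \<xi> \<Gamma> =
     {u. \<exists>(u' :: nat \<Rightarrow> complex \<times> complex) (x :: nat \<Rightarrow> complex \<times> complex).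
           u' \<longlonglongrightarrow> u \<and>
           (\<forall>n. affine_pt (x n) \<in> \<Gamma> - H_inf \<and> x n \<in> curve_reg f) \<and>
           (\<lambda>n. affine_pt (x n)) \<longlonglongrightarrow> \<xi> \<and>
           (\<forall>n. \<forall>v \<in> tangent f (x n). bil (u' n - x n) v = 0)}"

definition atyp :: "complex poly poly \<Rightarrow> (complex \<times> complex) set" where
  "atyp f = (\<Union>\<xi> \<in> X_inf f. \<Union>\<Gamma> \<in> {\<Gamma>. is_branch f \<xi> \<Gamma>}. atyp_branch f \<xi> \<Gamma>)"

definition h_fun ::
  "(complex \<Rightarrow> complex) \<Rightarrow> (complex \<Rightarrow> complex) \<Rightarrow> nat \<Rightarrow> complex \<times> complex \<Rightarrow> complex \<Rightarrow> complex" where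
  "h_fun P Q k u t =
     (t * deriv P t - of_nat k * P t) * (P t - fst u * t ^ k) +
     (t * deriv Q t - of_nat k * Q t) * (Q t - snd u * t ^ k)"

definition h_coeff ::
  "(complex \<Rightarrow> complex) \<Rightarrow> (complex \<Rightarrow> complex) \<Rightarrow> nat \<Rightarrow> nat \<Rightarrow> complex \<times> complex \<Rightarrow> complex" where
  "h_coeff P Q k j u = fps_nth (fps_expansion (h_fun P Q k u) 0) j"

(* (P, Q, k) are the data of the expansion x = P/t^k, y = Q/t^k of \<gamma> in affine coordinates. *)
definition affine_expansion ::
  "(complex \<Rightarrow> P2) \<Rightarrow> real \<Rightarrow> (complex \<Rightarrow> complex) \<Rightarrow> (complex \<Rightarrow> complex) \<Rightarrow> nat \<Rightarrow> bool" where
  "affine_expansion \<gamma> r P Q k \<longleftrightarrow>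
     P holomorphic_on ball 0 r \<and> Q holomorphic_on ball 0 r \<and> (P 0, Q 0) \<noteq> (0, 0) \<and> 1 \<le> k \<and>
     (\<forall>t \<in> ball 0 r - {0}. \<gamma> t = affine_pt (P t / t ^ k, Q t / t ^ k))"

end

theory Submission
  imports Defs "HOL-Computational_Algebra.Field_as_Ring"
    "HOL-Computational_Algebra.Polynomial_Factorial"
begin

text \<open>
  At a regular point of the branch the tangent line is spanned by \<open>(x', y')\<close>, so
  \<open>u \<in> \<Delta>\<close> means that \<open>h(t\<^sub>n, u\<^sub>n) = 0\<close> for some \<open>t\<^sub>n \<rightarrow> 0\<close> and \<open>u\<^sub>n \<rightarrow> u\<close>.
  If \<open>e\<^sup>2 = -1\<close>, \<open>A = P + e Q\<close>, \<open>B = P - e Q\<close>, \<open>\<alpha> = u\<^sub>1 + e u\<^sub>2\<close> and \<open>\<beta> = u\<^sub>1 - e u\<^sub>2\<close>, then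
  \<open>2 h = (t A' - k A)(B - \<beta> t\<^sup>k) + (t B' - k B)(A - \<alpha> t\<^sup>k)\<close>.
  For \<open>\<xi> \<notin> Q\<^sup>\<infinity>\<close> the value \<open>h(0, u)\<close> is a non-zero constant. For \<open>\<xi> \<in> Q\<^sup>\<infinity>\<close> and the right \<open>e\<close> one has
  \<open>A(0) = 0 \<noteq> B(0)\<close>. If \<open>A\<close> vanishes to an order \<open>m < k\<close>, then \<open>h\<close> is \<open>t\<^sup>m\<close> times a function
  whose value at \<open>0\<close> is non-zero and independent of \<open>u\<close>, so \<open>\<Delta>\<close> is empty; if \<open>A = t\<^sup>k a\<close>, then
  \<open>h\<close> is \<open>t\<^sup>k\<close> times a function with value \<open>-k B(0) (a(0) - \<alpha>) / 2\<close> at \<open>0\<close>, so \<open>\<Delta>\<close> is the isotropic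
  line \<open>\<alpha> = a(0)\<close>. In this case \<open>x + e y \<rightarrow> a(0)\<close> while \<open>y \<rightarrow> \<infinity>\<close> along the curve, so \<open>a(0)\<close> is a root
  of the leading coefficient of \<open>f\<close> with respect to \<open>y\<close>, written in the coordinates \<open>x + e y\<close> and
  \<open>y\<close>; this leaves finitely many lines.
\<close>

section \<open>Zeros of bivariate polynomials along a germ\<close>

lemma eval2_pCons [simp]: "eval2 (pCons c f) p = poly c (fst p) + snd p * eval2 f p"
  by (simp add: eval2_def)

lemma eval2_0 [simp]: "eval2 0 p = 0"
  by (simp add: eval2_def)

lemma eval2_1 [simp]: "eval2 1 p = 1"
  by (simp add: eval2_def)

lemma eval2_add [simp]: "eval2 (f + g) p = eval2 f p + eval2 g p"
  by (simp add: eval2_def)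

lemma eval2_diff [simp]: "eval2 (f - g) p = eval2 f p - eval2 g p"
  by (simp add: eval2_def)

lemma eval2_mult [simp]: "eval2 (f * g) p = eval2 f p * eval2 g p"
  by (simp add: eval2_def)

lemma eval2_smult [simp]: "eval2 (smult c f) p = poly c (fst p) * eval2 f p"
  by (simp add: eval2_def)

lemma poly_map_poly_eval: "poly (map_poly (\<lambda>p. poly p c) g) y = eval2 g (c, y)"
  by (induction g) (simp_all add: map_poly_pCons)

lemma dx_pCons: "dx (pCons c f) = pCons (pderiv c) (dx f)"
  by (simp add: dx_def map_poly_pCons)

lemma eval2_chain_rule:
  assumes "(x has_field_derivative x') (at t)" "(y has_field_derivative y') (at t)"
  shows "((\<lambda>t. eval2 f (x t, y t)) has_field_derivative
           eval2 (dx f) (x t, y t) * x' + eval2 (dy f) (x t, y t) * y') (at t)"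
proof (induction f)
  case 0
  then show ?case by (simp add: dx_def dy_def)
next
  case (pCons c f)
  have "((\<lambda>t. poly c (x t) + y t * eval2 f (x t, y t)) has_field_derivative
      poly (pderiv c) (x t) * x' + (y' * eval2 f (x t, y t) + 
        (eval2 (dx f) (x t, y t) * x' + eval2 (dy f) (x t, y t) * y') * y t)) (at t)"
    by (intro DERIV_add DERIV_mult assms pCons.IH DERIV_chain2[OF poly_DERIV])
  then show ?case
    by (simp add: dx_pCons dy_def pderiv_pCons algebra_simps)
qed

text \<open>\<open>eval2 (dx h) p\<close> is the derivative of \<open>h\<close> in the first
  variable with the second one frozen, so the product rule follows from the analytic one by
  uniqueness of derivatives.\<close>

lemma eval2_dx_mult:
  "eval2 (dx (f * g)) p = eval2 (dx f) p * eval2 g p + eval2 f p * eval2 (dx g) p"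
proof -
  have D: "((\<lambda>t. eval2 h (t, snd p)) has_field_derivative eval2 (dx h) p) (at (fst p))" for h
    using eval2_chain_rule[OF DERIV_ident DERIV_const, of h "snd p" "fst p"] by simp
  show ?thesis
    using DERIV_unique[OF D[of "f * g"], of "eval2 (dx f) p * eval2 g p + eval2 (dx g) p * eval2 f p"]
      DERIV_mult[OF D[of f] D[of g]] by simp
qed

lemma eval2_dy_mult:
  "eval2 (dy (f * g)) p = eval2 (dy f) p * eval2 g p + eval2 f p * eval2 (dy g) p"
  by (simp add: dy_def pderiv_mult)

text \<open>Isolates what the algebra needs from a punctured germ: by \<open>dichotomy\<close> the
  polynomials vanishing along it form a prime ideal, and \<open>nonconst\<close> prevents this ideal
  from being that of a single point.\<close>

locale curve_germ =
  fixes F :: "'a filter" and z :: "'a \<Rightarrow> complex \<times> complex"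
  assumes nontrivial: "F \<noteq> bot"
    and dichotomy: "(\<forall>\<^sub>F t in F. eval2 g (z t) = 0) \<or> (\<forall>\<^sub>F t in F. eval2 g (z t) \<noteq> 0)"
    and nonconst: "\<not> (\<forall>\<^sub>F t in F. z t = p)"
begin

definition vanishes :: "complex poly poly \<Rightarrow> bool" where
  "vanishes g \<longleftrightarrow> (\<forall>\<^sub>F t in F. eval2 g (z t) = 0)"

lemma not_vanishes: "\<not> vanishes g \<longleftrightarrow> (\<forall>\<^sub>F t in F. eval2 g (z t) \<noteq> 0)"
proof
  assume ne: "\<forall>\<^sub>F t in F. eval2 g (z t) \<noteq> 0"
  show "\<not> vanishes g"
  proof
    assume "vanishes g"
    then have "\<forall>\<^sub>F t in F. eval2 g (z t) = 0" by (simp add: vanishes_def)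
    with ne have "\<forall>\<^sub>F t in F. False" by eventually_elim simp
    with nontrivial show False by (simp add: eventually_False)
  qed
next
  assume "\<not> vanishes g"
  then show "\<forall>\<^sub>F t in F. eval2 g (z t) \<noteq> 0"
    using dichotomy[of g] unfolding vanishes_def by blast
qed

lemma vanishes_mult: "vanishes (g * h) \<longleftrightarrow> vanishes g \<or> vanishes h"
proof
  assume gh: "vanishes (g * h)"
  show "vanishes g \<or> vanishes h"
  proof (rule ccontr)
    assume "\<not> (vanishes g \<or> vanishes h)"
    then have "\<forall>\<^sub>F t in F. eval2 g (z t) \<noteq> 0" "\<forall>\<^sub>F t in F. eval2 h (z t) \<noteq> 0"
      by (simp_all add: not_vanishes)
    then have "\<forall>\<^sub>F t in F. eval2 (g * h) (z t) \<noteq> 0"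
      by eventually_elim simp
    then have "\<not> vanishes (g * h)" using not_vanishes by blast
    with gh show False by blast
  qed
qed (auto simp: vanishes_def elim: eventually_mono)

lemma not_vanishes_unit: assumes "g dvd 1" shows "\<not> vanishes g"
proof -
  obtain h where h: "1 = g * h" using assms by (rule dvdE)
  have "\<not> vanishes 1"
    by (simp add: not_vanishes)
  then show ?thesis unfolding h vanishes_mult by blast
qed

text \<open>If every value in \<open>A\<close> were eventually avoided, then so would be the finite
  set \<open>A\<close> as a whole.\<close>

lemma finite_values:
  assumes "finite A" "\<forall>\<^sub>F t in F. q t \<in> A"
    and "\<And>c. (\<forall>\<^sub>F t in F. q t = c) \<or> (\<forall>\<^sub>F t in F. q t \<noteq> c)"
  shows "\<exists>c\<in>A. \<forall>\<^sub>F t in F. q t = c"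
proof (rule ccontr)
  assume "\<not> ?thesis"
  then have "\<forall>c\<in>A. \<forall>\<^sub>F t in F. q t \<noteq> c" using assms(3) by blast
  then have "\<forall>\<^sub>F t in F. \<forall>c\<in>A. q t \<noteq> c"
    using assms(1) by (simp add: eventually_ball_finite)
  with assms(2) have "\<forall>\<^sub>F t in F. False" by eventually_elim blast
  with nontrivial show False by (simp add: eventually_False)
qed

lemma vanishes_const_poly:
  assumes "vanishes [:d:]" "d \<noteq> 0"
  shows "\<exists>c. \<forall>\<^sub>F t in F. fst (z t) = c"
proof -
  have "(\<forall>\<^sub>F t in F. fst (z t) = c) \<or> (\<forall>\<^sub>F t in F. fst (z t) \<noteq> c)" for c
    using dichotomy[of "[:[:-c, 1:]:]"] by simp
  then show ?thesis
    using finite_values[of "{c. poly d c = 0}" "\<lambda>t. fst (z t)"] assms poly_roots_finite[of d]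
    by (auto simp: vanishes_def)
qed

text \<open>On the line x = c the polynomial \<open>g\<close> restricts to \<open>q\<close>, a
  polynomial in y alone. If \<open>q\<close> were non-zero, y would be confined to its finitely many
  roots, hence be constant, and the germ would be a point.\<close>

lemma vanishes_vertical:
  assumes c: "\<forall>\<^sub>F t in F. fst (z t) = c" and g: "vanishes g"
  shows "[:[:-c, 1:]:] dvd g"
proof -
  define q where "q = map_poly (\<lambda>p. poly p c) g"
  have "q = 0"
  proof (rule ccontr)
    assume "q \<noteq> 0"
    have "\<forall>\<^sub>F t in F. poly q (snd (z t)) = 0"
      using c g[unfolded vanishes_def]
      by eventually_elim (metis poly_map_poly_eval prod.collapse q_def)
    moreover have "(\<forall>\<^sub>F t in F. snd (z t) = y) \<or> (\<forall>\<^sub>F t in F. snd (z t) \<noteq> y)" for y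
      using dichotomy[of "[:[:-y:], 1:]"] by simp
    ultimately obtain y where "\<forall>\<^sub>F t in F. snd (z t) = y"
      using finite_values[of "{c. poly q c = 0}" "\<lambda>t. snd (z t)"] poly_roots_finite[OF \<open>q \<noteq> 0\<close>]
      by auto
    with c have "\<forall>\<^sub>F t in F. z t = (c, y)"
      by eventually_elim (simp add: prod_eq_iff)
    with nonconst show False by blast
  qed
  then have "poly (coeff g n) c = 0" for n
    by (metis coeff_0 coeff_map_poly poly_0 q_def)
  then show ?thesis
    by (simp add: const_poly_dvd_iff poly_eq_0_iff_dvd)
qed

text \<open>Either the germ lies on a vertical line, or a vanishing polynomial \<open>q \<noteq> 0\<close> of least degree in
  \<open>y\<close> divides every vanishing polynomial up to a factor from \<open>\<complex>[x]\<close>.\<close>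

lemma prime_vanishes_dvd:
  assumes p: "prime_elem p" "vanishes p" and g: "vanishes g"
  shows "p dvd g"
proof (cases "\<exists>d. d \<noteq> 0 \<and> vanishes [:d:]")
  case True
  then obtain c where c: "\<forall>\<^sub>F t in F. fst (z t) = c"
    using vanishes_const_poly by blast
  let ?l = "[:[:-c, 1:]:] :: complex poly poly"
  obtain q where q: "p = ?l * q" using vanishes_vertical[OF c p(2)] by (rule dvdE)
  \<comment> \<open>The equation of the line vanishes along the germ, so it is no unit, and
    irreducibility of \<open>p\<close> makes the cofactor a unit: \<open>p\<close> and
    \<open>?l\<close> are associated.\<close>
  have "\<not> ?l dvd 1"
    using not_vanishes_unit[of ?l] c by (auto simp: vanishes_def elim: eventually_mono)
  then have "q dvd 1"
    using p(1) irreducibleD prime_elem_imp_irreducible q by blast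
  then have "p dvd ?l" using q by (metis dvd_mult_unit_iff dvd_refl)
  then show ?thesis using vanishes_vertical[OF c g] dvd_trans by blast
next
  case False
  define n where "n = (LEAST n. \<exists>q. q \<noteq> 0 \<and> vanishes q \<and> degree q = n)"
  have "\<exists>n q. q \<noteq> 0 \<and> vanishes q \<and> degree q = n"
    using p(2) prime_elem_not_zeroI[OF p(1)] by blast
  then have "\<exists>q. q \<noteq> 0 \<and> vanishes q \<and> degree q = n"
    unfolding n_def by (rule LeastI_ex)
  then obtain q where q: "q \<noteq> 0" "vanishes q" "degree q = n" by blast
  have min: "r = 0" if "vanishes r" "r = 0 \<or> degree r < degree q" for r
    using that q(3) not_less_Least[of "degree r" "\<lambda>n. \<exists>q. q \<noteq> 0 \<and> vanishes q \<and> degree q = n"]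
    unfolding n_def by auto
  have dvd: "\<exists>a. a \<noteq> 0 \<and> q dvd smult a g" if g: "vanishes g" for g
  proof -
    \<comment> \<open>The coefficients lie in a ring of polynomials, not in a field, so division
      with remainder by \<open>q\<close> costs a factor \<open>a\<close>.\<close>
    obtain a s where a: "a \<noteq> 0" "smult a g = q * s + pseudo_mod g q"
      and deg: "pseudo_mod g q = 0 \<or> degree (pseudo_mod g q) < degree q"
      using pseudo_mod[OF q(1)] by blast
    have "pseudo_mod g q = smult a g - q * s" using a by simp
    moreover have "vanishes (smult a g - q * s)"
      using g q(2) unfolding vanishes_def by eventually_elim simp
    ultimately have "pseudo_mod g q = 0" using min[OF _ deg] by simp
    then show ?thesis using a by (auto intro!: exI[of _ a])
  qed
  \<comment> \<open>This later strips the factor \<open>a\<close> left by the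
    pseudo-division.\<close>
  have const: "\<not> p dvd [:a:]" if "a \<noteq> 0" for a
  proof
    assume "p dvd [:a:]"
    then obtain s where "[:a:] = p * s" by (rule dvdE)
    then have "vanishes [:a:]" using p(2) by (simp add: vanishes_mult del: eval2_pCons)
    then show False using False that by blast
  qed
  have "p dvd q"
  proof -
    obtain a s where a: "a \<noteq> 0" "smult a p = q * s" using dvd[OF p(2)] by (auto simp: dvd_def)
    then have "p dvd q * s" by (metis dvd_refl dvd_smult)
    moreover have "\<not> p dvd s"
    proof
      assume "p dvd s"
      then obtain s' where "s = p * s'" by (rule dvdE)
      then have "p * [:a:] = p * (q * s')" using a by (simp add: mult_ac)
      then have "[:a:] = q * s'" using p(1) by (metis mult_cancel_left prime_elem_not_zeroI)
      then have "vanishes [:a:]" using q(2) by (simp add: vanishes_mult del: eval2_pCons)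
      then show False using False a by blast
    qed
    ultimately show ?thesis using p(1) prime_elem_dvd_mult_iff by blast
  qed
  obtain a where a: "a \<noteq> 0" "q dvd smult a g" using dvd[OF g] by blast
  then have "p dvd [:a:] * g" using \<open>p dvd q\<close> dvd_trans by simp blast
  then show ?thesis using const a p(1) prime_elem_dvd_mult_iff by blast
qed

lemma vanishes_prime_factor:
  assumes "g \<noteq> 0" "vanishes g"
  shows "\<exists>p. prime_elem p \<and> p dvd g \<and> vanishes p"
  using assms
proof (induction g rule: prime_divisors_induct)
  case (unit g)
  then show ?case using not_vanishes_unit by blast
next
  case (factor p g)
  show ?case
  proof (cases "vanishes p")
    case True
    then show ?thesis using factor.hyps by (intro exI[of _ p]) auto
  next
    case False
    then show ?thesis using factor by (auto simp: vanishes_mult)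
  qed
qed simp

text \<open>A prime factor \<open>p\<close> of \<open>f\<close> vanishes along the germ, and its
  cofactor \<open>q\<close> does not because \<open>f\<close> is squarefree. There the partial
  derivatives of \<open>f\<close> are those of \<open>p\<close> times \<open>q\<close>; if both
  vanished, \<open>p\<close> would divide its own partial derivatives.\<close>

lemma eventually_regular:
  assumes f: "squarefree f" "vanishes f"
  shows "\<forall>\<^sub>F t in F. z t \<in> curve_reg f"
proof -
  have "f \<noteq> 0" using f(1) by auto
  then obtain p where p: "prime_elem p" "p dvd f" "vanishes p"
    using vanishes_prime_factor f by blast
  then obtain q where q: "f = p * q" by (auto elim: dvdE)
  have "\<not> p dvd q"
  proof
    assume "p dvd q"
    then have "p\<^sup>2 dvd f" using q by (auto simp: power2_eq_square)
    then have "p dvd 1" using f(1) squarefreeD by blast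
    then show False using p(1) by auto
  qed
  then have nq: "\<not> vanishes q" using prime_vanishes_dvd p by blast
  have "\<not> (vanishes (dx f) \<and> vanishes (dy f))"
  proof
    assume v: "vanishes (dx f) \<and> vanishes (dy f)"
    have "vanishes (dx p * q)"
      using conjunct1[OF v] p(3) unfolding vanishes_def
      by eventually_elim (simp add: q eval2_dx_mult)
    moreover have "vanishes (dy p * q)"
      using conjunct2[OF v] p(3) unfolding vanishes_def
      by eventually_elim (simp add: q eval2_dy_mult)
    ultimately have "p dvd dx p" "p dvd dy p"
      using nq prime_vanishes_dvd p by (auto simp: vanishes_mult)
    \<comment> \<open>In characteristic 0 a polynomial divides its derivative only if it is
      constant. This is applied first in y, then in x.\<close>
    then have "degree p = 0"
      using dvd_pderiv_iff[of p] by (simp add: dy_def)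
    then obtain c where c: "p = [:c:]" by (rule degree_eq_zeroE)
    then have "c dvd pderiv c" using \<open>p dvd dx p\<close>
      by (simp add: dx_def map_poly_pCons)
    then have "degree c = 0" by simp
    then obtain c' where "c = [:c':]" by (rule degree_eq_zeroE)
    then have p': "p = [:[:c':]:]" using c by simp
    then have "c' \<noteq> 0" using prime_elem_not_zeroI[OF p(1)] by auto
    then have "1 = p * [:[:1 / c':]:]"
      using p' by (simp add: one_pCons)
    then have "p dvd 1" by (rule dvdI)
    then show False using prime_elem_not_unit[OF p(1)] by blast
  qed
  then have "(\<forall>\<^sub>F t in F. eval2 (dx f) (z t) \<noteq> 0) \<or> (\<forall>\<^sub>F t in F. eval2 (dy f) (z t) \<noteq> 0)"
    by (simp add: not_vanishes)
  then have "\<forall>\<^sub>F t in F. (eval2 (dx f) (z t), eval2 (dy f) (z t)) \<noteq> (0, 0)"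
    by (auto elim: eventually_mono)
  with f(2)[unfolded vanishes_def] show ?thesis
    by eventually_elim (simp add: curve_reg_def curve_def)
qed

end

section \<open>The projective plane and parametrized branches\<close>

lemma vector3_eq_0_iff: "(vector [a, b, c] :: complex ^ 3) = 0 \<longleftrightarrow> a = 0 \<and> b = 0 \<and> c = 0"
  by (simp add: vec_eq_iff forall_3)

lemma vector3_nth_id: "vector [v $ 1, v $ 2, v $ 3] = (v :: complex ^ 3)"
  by (simp add: vec_eq_iff forall_3)

lemma proj_eq_iff:
  fixes v w :: "complex ^ 3"
  assumes "v \<noteq> 0" "w \<noteq> 0"
  shows "proj v = proj w \<longleftrightarrow> (\<exists>c. c \<noteq> 0 \<and> w = c *s v)"
proof -
  have refl: "proj_rel v v" if "v \<noteq> 0" for v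
    using that unfolding proj_rel_def by (metis one_neq_zero vector_smult_lid)
  show ?thesis
    using Quotient3_rel[OF Quotient3_P2, of v w] assms refl
    unfolding proj_def by (auto simp: proj_rel_def)
qed

lemma proj_minors:
  fixes v w :: "complex ^ 3"
  assumes "proj v = proj w" "v \<noteq> 0" "w \<noteq> 0"
  shows "v $ i * w $ j = v $ j * w $ i"
  using assms by (auto simp: proj_eq_iff)

text \<open>Minors replace the scaling factor as a test of equality because they are continuous in
  the coordinates, so that the test passes to limits, as \<open>lift_eq\<close> requires.\<close>

lemma proj_eqI:
  fixes v w :: "complex ^ 3"
  assumes "v \<noteq> 0" "w \<noteq> 0" and minors: "\<And>i j. v $ i * w $ j = v $ j * w $ i"
  shows "proj v = proj w"
proof -
  obtain i where i: "v $ i \<noteq> 0" using assms(1) by (auto simp: vec_eq_iff)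
  have w: "w = (w $ i / v $ i) *s v"
    using i minors by (auto simp: vec_eq_iff field_simps)
  moreover have "w $ i / v $ i \<noteq> 0"
  proof
    assume "w $ i / v $ i = 0"
    then have "w = 0" using w by (metis vector_smult_lzero)
    then show False using assms(2) by blast
  qed
  ultimately show ?thesis using assms(1,2) proj_eq_iff by blast
qed

lemma proj_in_H_inf_iff:
  fixes v :: "complex ^ 3"
  assumes "v \<noteq> 0"
  shows "proj v \<in> H_inf \<longleftrightarrow> v $ 3 = 0"
proof
  assume "proj v \<in> H_inf"
  then obtain x y where xy: "proj v = proj (vector [x, y, 0])" "(x, y) \<noteq> (0, 0)"
    unfolding H_inf_def by blast
  let ?w = "vector [x, y, 0] :: complex ^ 3"
  have "?w \<noteq> 0" using xy(2) by (auto simp: vector3_eq_0_iff)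
  then show "v $ 3 = 0"
    using proj_minors[OF xy(1) assms, of 1 3] proj_minors[OF xy(1) assms, of 2 3] xy(2)
    by auto
next
  assume 0: "v $ 3 = 0"
  then have v: "v = vector [v $ 1, v $ 2, 0]" using vector3_nth_id[of v] by simp
  then have "(v $ 1, v $ 2) \<noteq> (0, 0)" using assms vector3_eq_0_iff by auto
  then have "proj (vector [v $ 1, v $ 2, 0]) \<in> H_inf" unfolding H_inf_def by blast
  then show "proj v \<in> H_inf" using v by simp
qed

lemma affine_pt_notin_H_inf: "affine_pt p \<notin> H_inf"
  by (simp add: affine_pt_def proj_in_H_inf_iff vector3_eq_0_iff)

lemma affine_pt_eq_iff [simp]: "affine_pt p = affine_pt q \<longleftrightarrow> p = q"
proof
  assume "affine_pt p = affine_pt q"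
  then have eq: "proj (vector [fst p, snd p, 1]) = proj (vector [fst q, snd q, 1])"
    by (simp add: affine_pt_def)
  show "p = q"
    using proj_minors[OF eq, of 1 3] proj_minors[OF eq, of 2 3]
    by (simp add: vector3_eq_0_iff prod_eq_iff)
qed simp

lemma proj_eq_affine_pt:
  fixes v :: "complex ^ 3"
  assumes "v $ 3 \<noteq> 0"
  shows "proj v = affine_pt (v $ 1 / v $ 3, v $ 2 / v $ 3)"
proof -
  let ?w = "vector [v $ 1 / v $ 3, v $ 2 / v $ 3, 1] :: complex ^ 3"
  have "?w = inverse (v $ 3) *s v"
    using assms by (simp add: vec_eq_iff forall_3 divide_inverse mult.commute)
  moreover have "v \<noteq> 0" "?w \<noteq> 0" using assms by (auto simp: vector3_eq_0_iff)
  ultimately show ?thesis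
    using assms proj_eq_iff[of v ?w] nonzero_imp_inverse_nonzero unfolding affine_pt_def by auto
qed

lemma tendsto_vector3:
  assumes "(a \<longlongrightarrow> a') F" "(b \<longlongrightarrow> b') F" "(c \<longlongrightarrow> c') F"
  shows "((\<lambda>t. vector [a t, b t, c t] :: complex ^ 3) \<longlongrightarrow> vector [a', b', c']) F"
proof (rule vec_tendstoI)
  have "\<forall>i. ((\<lambda>t. (vector [a t, b t, c t] :: complex ^ 3) $ i) \<longlongrightarrow> vector [a', b', c'] $ i) F"
    using assms by (simp add: forall_3)
  then show "((\<lambda>t. (vector [a t, b t, c t] :: complex ^ 3) $ i) \<longlongrightarrow> vector [a', b', c'] $ i) F" for i
    by blast
qed

lemma tendsto_proj:
  assumes "(g \<longlongrightarrow> v) F" "v \<noteq> 0"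
  shows "((\<lambda>t. proj (g t)) \<longlongrightarrow> proj v) F"
proof (rule topological_tendstoI)
  fix S :: "P2 set"
  assume "open S" "proj v \<in> S"
  then have "open {v. v \<noteq> 0 \<and> proj v \<in> S}" by (simp add: open_P2_def)
  then have "\<forall>\<^sub>F t in F. g t \<in> {v. v \<noteq> 0 \<and> proj v \<in> S}"
    using assms \<open>proj v \<in> S\<close> by (auto dest: topological_tendstoD)
  then show "\<forall>\<^sub>F t in F. proj (g t) \<in> S" by eventually_elim simp
qed

text \<open>The cone over the image consists of the vectors with non-zero third coordinate whose
  dehomogenization lies in \<open>S\<close>.\<close>

lemma open_affine_pt_image:
  assumes "open S"
  shows "open (affine_pt ` S)"
proof -
  have "{v :: complex ^ 3. v \<noteq> 0 \<and> proj v \<in> affine_pt ` S} =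
      {v. v $ 3 \<noteq> 0} \<inter> (\<lambda>v. (v $ 1 / v $ 3, v $ 2 / v $ 3)) -` S"
    (is "?L = ?R")
  proof (intro equalityI subsetI)
    fix v assume "v \<in> ?L"
    then obtain p where v: "v \<noteq> 0" "p \<in> S" "proj v = affine_pt p" by blast
    then have "proj v \<notin> H_inf" using affine_pt_notin_H_inf by simp
    then have "v $ 3 \<noteq> 0" using v proj_in_H_inf_iff by blast
    then show "v \<in> ?R" using v proj_eq_affine_pt[of v] by simp
  next
    fix v assume "v \<in> ?R"
    then show "v \<in> ?L" using proj_eq_affine_pt[of v] by auto
  qed
  moreover have "open {v :: complex ^ 3. v $ 3 \<noteq> 0}"
    by (intro open_Collect_neq continuous_intros)
  then have "open ({v :: complex ^ 3. v $ 3 \<noteq> 0} \<inter> (\<lambda>v. (v $ 1 / v $ 3, v $ 2 / v $ 3)) -` S)"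
    using assms by (intro continuous_open_preimage continuous_intros) auto
  ultimately show ?thesis by (simp add: open_P2_def)
qed

text \<open>Since the affine chart is open and injective, the complement of \<open>S\<close> maps to
  an open set that misses the image of \<open>S\<close>, hence also its closure.\<close>

lemma affine_pt_in_proj_closure:
  assumes "closed S" "affine_pt p \<in> proj_closure S"
  shows "p \<in> S"
proof (rule ccontr)
  assume "p \<notin> S"
  have "affine_pt p \<in> affine_pt ` (- S)" using \<open>p \<notin> S\<close> by blast
  moreover have "open (affine_pt ` (- S))"
    using assms(1) by (intro open_affine_pt_image) auto
  ultimately have "affine_pt ` (- S) \<inter> affine_pt ` S \<noteq> {}"
    using assms(2) open_Int_closure_eq_empty unfolding proj_closure_def by blast
  then show False by auto
qed

lemma continuous_on_eval2 [continuous_intros]: "continuous_on S (eval2 f)"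
proof (induction f)
  case (pCons c f)
  then have "continuous_on S (\<lambda>p. poly c (fst p) + snd p * eval2 f p)"
    by (intro continuous_intros)
  then show ?case by (simp cong: continuous_on_cong)
qed (simp add: continuous_on_const cong: continuous_on_cong)

lemma closed_curve: "closed (curve f)"
  unfolding curve_def by (intro closed_Collect_eq continuous_intros)

lemma proj_Q_inf:
  assumes "proj (vector [a, b, 0]) \<in> Q_inf" "(a, b) \<noteq> (0, 0)"
  shows "a\<^sup>2 + b\<^sup>2 = 0"
proof -
  obtain x y where xy: "proj (vector [a, b, 0]) = proj (vector [x, y, 0])"
    "(x, y) \<noteq> (0, 0)" "x\<^sup>2 + y\<^sup>2 = 0"
    using assms(1) unfolding Q_inf_def by blast
  have "a * y = b * x"
    using proj_minors[OF xy(1), of 1 2] assms(2) xy(2) by (auto simp: vector3_eq_0_iff)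
  moreover have "x \<noteq> 0" using xy(2,3) by auto
  ultimately have "(a\<^sup>2 + b\<^sup>2) * x\<^sup>2 = a\<^sup>2 * (x\<^sup>2 + y\<^sup>2)"
    by (simp add: algebra_simps flip: power_mult_distrib)
  then show ?thesis using xy(3) \<open>x \<noteq> 0\<close> by simp
qed

text \<open>The slope \<open>e\<close> ranges over the two square roots of \<open>-1\<close>, which give the two isotropic points.\<close>

lemma isotropic_line_slope:
  assumes "e\<^sup>2 = -1"
  shows "isotropic_line {u. fst u + e * snd u = c}"
proof -
  let ?L = "{u. fst u + e * snd u = c}"
  have "?L = {(x, y). 1 * x + e * y = c}" by auto
  then have "is_line ?L"
    unfolding is_line_def using one_neq_zero by blast
  moreover have "proj (vector [-e, 1, 0]) \<in> proj_closure ?L"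
  proof -
    \<comment> \<open>Points of the line that run to infinity; division by the second coordinate
      gives representatives that converge to \<open>(-e, 1, 0)\<close>.\<close>
    define p where "p n = (c - e * of_nat (Suc n), of_nat (Suc n) :: complex)" for n
    let ?s = "\<lambda>n. inverse (of_nat (Suc n)) :: complex"
    have p: "affine_pt (p n) = proj (vector [c * ?s n - e, 1, ?s n])" for n
    proof -
      have "(vector [c * ?s n - e, 1, ?s n] :: complex ^ 3) $ 3 \<noteq> 0" by (simp del: of_nat_Suc)
      from proj_eq_affine_pt[OF this] show ?thesis
        by (simp add: p_def divide_inverse algebra_simps del: of_nat_Suc)
    qed
    have "?s \<longlonglongrightarrow> 0" 
      using LIMSEQ_Suc[OF lim_inverse_n] by simp
    then have "(\<lambda>n. vector [c * ?s n - e, 1, ?s n] :: complex ^ 3) \<longlonglongrightarrow> vector [c * 0 - e, 1, 0]"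
      by (intro tendsto_vector3 tendsto_intros)
    then have "(\<lambda>n. proj (vector [c * ?s n - e, 1, ?s n])) \<longlonglongrightarrow> proj (vector [c * 0 - e, 1, 0])"
      by (intro tendsto_proj) (simp_all add: vector3_eq_0_iff)
    then have lim: "(\<lambda>n. affine_pt (p n)) \<longlonglongrightarrow> proj (vector [-e, 1, 0])" by (simp add: p)
    show ?thesis
      unfolding proj_closure_def
    proof (rule Lim_in_closed_set[OF closed_closure _ _ lim])
      show "\<forall>\<^sub>F n in sequentially. affine_pt (p n) \<in> closure (affine_pt ` ?L)"
        by (intro always_eventually allI closure_subset[THEN subsetD] imageI) (simp add: p_def)
    qed simp
  qed
  moreover have "proj (vector [-e, 1, 0]) \<in> Q_inf"
  proof -
    have "(-e, 1 :: complex) \<noteq> (0, 0) \<and> (-e)\<^sup>2 + 1\<^sup>2 = 0" using assms by simp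
    then show ?thesis unfolding Q_inf_def by blast
  qed
  ultimately show ?thesis unfolding isotropic_line_def by blast
qed

section \<open>Local inverse and restriction of a branch parametrization\<close>

lemma branch_param_inj: "branch_param \<xi> \<Gamma> \<gamma> r \<Longrightarrow> inj_on \<gamma> (ball 0 r)"
  unfolding branch_param_def homeomorphism_def by (metis inj_on_inverseI)

lemma branch_param_continuous: "branch_param \<xi> \<Gamma> \<gamma> r \<Longrightarrow> continuous_on (ball 0 r) \<gamma>"
  unfolding branch_param_def homeomorphism_def by blast

lemma branch_param_subset: "branch_param \<xi> \<Gamma> \<gamma> r \<Longrightarrow> \<gamma> ` ball 0 r \<subseteq> \<Gamma>"
  unfolding branch_param_def by (metis openin_imp_subset)

text \<open>The image of the disk is open in \<open>\<Gamma>\<close>, hence cut out of it by an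
  ambient open set \<open>W\<close>, on which the inverse homeomorphism lives.\<close>

lemma branch_param_inverse:
  assumes "branch_param \<xi> \<Gamma> \<gamma> r"
  obtains \<delta> W where "open W" "\<xi> \<in> W" "continuous_on (\<Gamma> \<inter> W) \<delta>"
    "\<And>x. x \<in> \<Gamma> \<inter> W \<Longrightarrow> \<delta> x \<in> ball 0 r \<and> \<gamma> (\<delta> x) = x"
    "\<And>t. t \<in> ball 0 r \<Longrightarrow> \<gamma> t \<in> \<Gamma> \<inter> W \<and> \<delta> (\<gamma> t) = t"
proof -
  obtain \<delta> where \<delta>: "homeomorphism (ball 0 r) (\<gamma> ` ball 0 r) \<gamma> \<delta>"
    using assms unfolding branch_param_def by blast
  obtain W where W: "open W" "\<gamma> ` ball 0 r = \<Gamma> \<inter> W"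
    using assms unfolding branch_param_def openin_open by blast
  have \<xi>: "\<xi> \<in> \<gamma> ` ball 0 r"
    using assms unfolding branch_param_def by force
  have "\<delta> x \<in> ball 0 r \<and> \<gamma> (\<delta> x) = x" if "x \<in> \<gamma> ` ball 0 r" for x
    using \<delta> that unfolding homeomorphism_def by blast
  moreover have "\<gamma> t \<in> \<gamma> ` ball 0 r \<and> \<delta> (\<gamma> t) = t" if "t \<in> ball 0 r" for t
    using \<delta> that unfolding homeomorphism_def by blast
  moreover have "continuous_on (\<gamma> ` ball 0 r) \<delta>"
    using \<delta> unfolding homeomorphism_def by blast
  ultimately show ?thesis
    using \<xi> W(1) by (intro that[of W \<delta>]) (simp_all add: W(2))
qed

text \<open>Turns points of the branch that tend to \<open>\<xi>\<close> into parameters that tend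
  to 0, by continuity of the inverse at \<open>\<xi>\<close>.\<close>

lemma branch_param_sequence:
  assumes bp: "branch_param \<xi> \<Gamma> \<gamma> r" and x: "(x \<longlongrightarrow> \<xi>) F" "\<forall>\<^sub>F n in F. x n \<in> \<Gamma>"
  obtains t where "(t \<longlongrightarrow> 0) F" "\<forall>\<^sub>F n in F. t n \<in> ball 0 r \<and> \<gamma> (t n) = x n"
proof -
  obtain \<delta> W where W: "open W" "\<xi> \<in> W" "continuous_on (\<Gamma> \<inter> W) \<delta>"
    and \<delta>: "\<And>x. x \<in> \<Gamma> \<inter> W \<Longrightarrow> \<delta> x \<in> ball 0 r \<and> \<gamma> (\<delta> x) = x"
    "\<And>t. t \<in> ball 0 r \<Longrightarrow> \<gamma> t \<in> \<Gamma> \<inter> W \<and> \<delta> (\<gamma> t) = t"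
    using branch_param_inverse[OF bp] by metis
  have r: "0 \<in> ball (0 :: complex) r" "\<gamma> 0 = \<xi>" using bp by (auto simp: branch_param_def)
  have ev: "\<forall>\<^sub>F n in F. x n \<in> \<Gamma> \<inter> W"
    using topological_tendstoD[OF x(1) W(1,2)] x(2) by eventually_elim blast
  have "((\<lambda>n. \<delta> (x n)) \<longlongrightarrow> \<delta> \<xi>) F"
    using \<delta>(2)[OF r(1)] r(2) by (intro continuous_on_tendsto_compose[OF W(3) x(1) _ ev]) auto
  then have "((\<lambda>n. \<delta> (x n)) \<longlongrightarrow> 0) F" using \<delta>(2)[OF r(1)] r(2) by simp
  moreover have "\<forall>\<^sub>F n in F. \<delta> (x n) \<in> ball 0 r \<and> \<gamma> (\<delta> (x n)) = x n"
    using ev by eventually_elim (use \<delta>(1) in blast)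
  ultimately show ?thesis by (rule that)
qed

lemma branch_param_shrink:
  assumes bp: "branch_param \<xi> \<Gamma> \<gamma> r" and s: "0 < s" "s \<le> r"
  shows "branch_param \<xi> \<Gamma> \<gamma> s"
proof -
  have sub: "ball 0 s \<subseteq> ball (0 :: complex) r" using s by auto
  obtain \<delta> where \<delta>: "homeomorphism (ball 0 r) (\<gamma> ` ball 0 r) \<gamma> \<delta>"
    using bp unfolding branch_param_def by blast
  have "openin (top_of_set (\<gamma> ` ball 0 r)) (\<gamma> ` ball 0 s)"
    using sub by (intro homeomorphism_imp_open_map[OF \<delta>]) (simp add: openin_open_eq)
  then have "openin (top_of_set \<Gamma>) (\<gamma> ` ball 0 s)"
    using bp openin_trans unfolding branch_param_def by blast
  moreover have "homeomorphism (ball 0 s) (\<gamma> ` ball 0 s) \<gamma> \<delta>"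
    using sub by (intro homeomorphism_of_subsets[OF \<delta>]) auto
  moreover have "holomorphic_P2 \<gamma> (ball 0 s)"
    unfolding holomorphic_P2_def
  proof
    fix t :: complex assume t: "t \<in> ball 0 s"
    then obtain U F where U: "open U" "t \<in> U" "holomorphic_lift F U \<gamma>"
      using bp sub unfolding branch_param_def holomorphic_P2_def by blast
    have "holomorphic_lift F (U \<inter> ball 0 s) \<gamma>"
      using U(3) unfolding holomorphic_lift_def by (auto intro: holomorphic_on_subset)
    then show "\<exists>U F. open U \<and> t \<in> U \<and> U \<subseteq> ball 0 s \<and> holomorphic_lift F U \<gamma>"
      using U(1,2) t by (intro exI[of _ "U \<inter> ball 0 s"] exI[of _ F]) auto
  qed
  ultimately show ?thesis
    using s bp unfolding branch_param_def by blast
qed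

section \<open>Atypical values as limits of zeros of h\<close>

text \<open>Here \<open>\<xi>\<close> may be any point at infinity, isotropic or not, since the
  finiteness statement ranges over all of \<open>X_inf\<close>.\<close>

locale branch_expansion =
  fixes f :: "complex poly poly" and \<xi> \<Gamma> \<gamma> r P Q k
  assumes reduced: "reduced_curve f"
    and sub: "\<Gamma> \<subseteq> proj_closure (curve f)"
    and param: "branch_param \<xi> \<Gamma> \<gamma> r"
    and expansion: "affine_expansion \<gamma> r P Q k"
begin

lemma r_pos: "0 < r" and \<gamma>_0: "\<gamma> 0 = \<xi>"
  using param by (auto simp: branch_param_def)

lemma holo: "P holomorphic_on ball 0 r" "Q holomorphic_on ball 0 r"
  and PQ_0: "(P 0, Q 0) \<noteq> (0, 0)" and k_pos: "0 < k"
  and \<gamma>_eq: "\<And>t. t \<in> ball 0 r - {0} \<Longrightarrow> \<gamma> t = affine_pt (P t / t ^ k, Q t / t ^ k)"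
  using expansion by (auto simp: affine_expansion_def)

lemma analytic_PQ: "P analytic_on {0}" "Q analytic_on {0}"
  using holo r_pos analytic_at_ball by blast+

lemma tendsto_PQ: "P \<midarrow>0\<rightarrow> P 0" "Q \<midarrow>0\<rightarrow> Q 0" 
    "deriv P \<midarrow>0\<rightarrow> deriv P 0" "deriv Q \<midarrow>0\<rightarrow> deriv Q 0"
  using analytic_PQ by (simp_all add: analytic_at_imp_isCont analytic_deriv flip: isCont_def)

definition z :: "complex \<Rightarrow> complex \<times> complex" where
  "z t = (P t / t ^ k, Q t / t ^ k)"

lemma z_inj: assumes "s \<in> ball 0 r - {0}" "t \<in> ball 0 r - {0}" "z s = z t" shows "s = t"
proof -
  have "\<gamma> s = \<gamma> t" using assms \<gamma>_eq by (simp add: z_def)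
  then show ?thesis using branch_param_inj[OF param] assms by (auto dest: inj_onD)
qed

lemma eventually_punctured: "\<forall>\<^sub>F t in at 0. t \<in> ball 0 r - {0}"
  using r_pos by (intro eventually_at_in_open) auto

lemma z_on_curve:
  assumes "t \<in> ball 0 r - {0}"
  shows "eval2 f (z t) = 0"
proof -
  have "\<gamma> t \<in> \<gamma> ` ball 0 r" using assms by blast
  then have "affine_pt (z t) \<in> proj_closure (curve f)"
    using branch_param_subset[OF param] sub \<gamma>_eq[OF assms] unfolding z_def by auto
  then show ?thesis
    using affine_pt_in_proj_closure[OF closed_curve] by (auto simp: curve_def)
qed

lemma lift_nz: "t \<in> ball 0 r \<Longrightarrow> (vector [P t, Q t, t ^ k] :: complex ^ 3) \<noteq> 0"
  using PQ_0 k_pos by (auto simp: vector3_eq_0_iff)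

text \<open>The expansion describes \<open>\<gamma>\<close> only for \<open>t \<noteq> 0\<close>. At
  0 the vector is compared with a local holomorphic lift \<open>G\<close>: the minors of the two
  vanish on a punctured neighbourhood, hence at 0 by continuity.\<close>

lemma lift_eq:
  assumes "t \<in> ball 0 r"
  shows "\<gamma> t = proj (vector [P t, Q t, t ^ k])"
proof (cases "t = 0")
  case False
  then show ?thesis
    using assms \<gamma>_eq[of t] proj_eq_affine_pt[of "vector [P t, Q t, t ^ k]"] by simp
next
  case True
  obtain U G where U: "open U" "0 \<in> U" "U \<subseteq> ball 0 r" and G: "holomorphic_lift G U \<gamma>"
    using param unfolding branch_param_def holomorphic_P2_def by (metis centre_in_ball)
  let ?v = "\<lambda>t. vector [P t, Q t, t ^ k] :: complex ^ 3"
  have G_nz: "G t \<noteq> 0" "\<gamma> t = proj (G t)" if "t \<in> U" for t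
    using G that unfolding holomorphic_lift_def by auto
  have v_lim: "((\<lambda>t. ?v t $ i) \<longlongrightarrow> ?v 0 $ i) (at 0)" for i
    by (intro tendsto_vec_nth tendsto_vector3 tendsto_PQ tendsto_intros)
  have G_lim: "((\<lambda>t. G t $ i) \<longlongrightarrow> G 0 $ i) (at 0)" for i
  proof -
    have "continuous_on U (\<lambda>t. G t $ i)"
      using G unfolding holomorphic_lift_def by (auto intro: holomorphic_on_imp_continuous_on)
    then show ?thesis using U by (simp add: continuous_on_eq_continuous_at isCont_def)
  qed
  have "proj (G 0) = proj (?v 0)"
  proof (rule proj_eqI)
    fix i j
    let ?d = "\<lambda>t. G t $ i * ?v t $ j - G t $ j * ?v t $ i"
    have "(?d \<longlongrightarrow> ?d 0) (at 0)"
      by (intro tendsto_intros v_lim G_lim)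
    moreover have "\<forall>\<^sub>F t in at 0. ?d t = 0"
    proof -
      have "\<forall>\<^sub>F t in at 0. t \<in> U - {0}" using U by (intro eventually_at_in_open) auto
      then show ?thesis
      proof eventually_elim
        fix t assume t: "t \<in> U - {0}"
        then have "proj (G t) = proj (?v t)"
          using U G_nz[of t] \<gamma>_eq[of t] proj_eq_affine_pt[of "?v t"] by auto
        then show "?d t = 0"
          using proj_minors G_nz t U lift_nz by (simp add: subset_iff)
      qed
    qed
    then have "(?d \<longlongrightarrow> 0) (at 0)" by (rule tendsto_eventually)
    ultimately have "?d 0 = 0" using tendsto_unique by (metis (no_types, lifting) at_neq_bot)
    then show "G 0 $ i * ?v 0 $ j = G 0 $ j * ?v 0 $ i" by simp
  qed (use G_nz lift_nz U in auto)
  then show ?thesis using True G_nz(2) U by simp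
qed

lemma \<xi>_eq: "\<xi> = proj (vector [P 0, Q 0, 0])"
  using lift_eq[of 0] r_pos k_pos \<gamma>_0 by (simp add: zero_power)

lemma \<xi>_H_inf: "\<xi> \<in> H_inf"
  using lift_nz[of 0] r_pos k_pos by (simp add: \<xi>_eq proj_in_H_inf_iff zero_power)

lemma meromorphic_z: "(\<lambda>t. eval2 g (z t)) meromorphic_on {0}"
proof (induction g)
  case (pCons c g)
  have xy: "(\<lambda>t. fst (z t)) meromorphic_on {0}" "(\<lambda>t. snd (z t)) meromorphic_on {0}"
    unfolding z_def fst_conv snd_conv
    by (intro meromorphic_intros analytic_PQ[THEN analytic_on_imp_meromorphic_on])+
  have "(\<lambda>t. poly c (fst (z t))) meromorphic_on {0}"
    by (induction c) (auto intro!: meromorphic_intros xy)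
  then show ?case using pCons.IH xy by (auto intro!: meromorphic_intros)
qed (auto intro: meromorphic_intros)

sublocale curve_germ "at 0" z
proof
  fix g
  show "(\<forall>\<^sub>F t in at 0. eval2 g (z t) = 0) \<or> (\<forall>\<^sub>F t in at 0. eval2 g (z t) \<noteq> 0)"
    \<comment> \<open>A meromorphic function with zeros accumulating at 0 vanishes identically near
      0.\<close>
    using meromorphic_z[of g] not_essential_frequently_0_imp_eventually_0[of "\<lambda>t. eval2 g (z t)" 0]
    by (auto simp: meromorphic_at_iff frequently_def)
next
  fix p
  show "\<not> (\<forall>\<^sub>F t in at 0. z t = p)"
  proof
    assume "\<forall>\<^sub>F t in at 0. z t = p"
    with eventually_punctured have "\<forall>\<^sub>F t in at 0. t \<in> ball 0 r - {0} \<and> z t = p"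
      by eventually_elim blast
    then obtain d where d: "d > 0" "\<And>t. t \<noteq> 0 \<Longrightarrow> norm t < d \<Longrightarrow> t \<in> ball 0 r - {0} \<and> z t = p"
      unfolding eventually_at by auto
    have "z (of_real (d / 2)) = z (of_real (d / 3))"
      "of_real (d / 2) \<in> ball 0 r - {0 :: complex}" "of_real (d / 3) \<in> ball 0 r - {0 :: complex}"
      using d(1) d(2)[of "of_real (d / 2)"] d(2)[of "of_real (d / 3)"] 
      by (simp_all del: of_real_divide add: norm_of_real)
    then have "complex_of_real (d / 2) = of_real (d / 3)" using z_inj by blast
    then show False using d(1) unfolding of_real_eq_iff by simp
  qed
qed simp

lemma eventually_z_regular: "\<forall>\<^sub>F t in at 0. z t \<in> curve_reg f"
proof (rule eventually_regular)
  show "squarefree f" using reduced by (simp add: reduced_curve_def)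
  show "vanishes f"
    unfolding vanishes_def using eventually_punctured by eventually_elim (rule z_on_curve)
qed

text \<open>The vector \<open>(p t, q t)\<close> is the velocity of \<open>z\<close> at
  \<open>t\<close>, multiplied by \<open>t ^ Suc k\<close> to clear the pole.\<close>

definition p :: "complex \<Rightarrow> complex" where "p t = t * deriv P t - of_nat k * P t"
definition q :: "complex \<Rightarrow> complex" where "q t = t * deriv Q t - of_nat k * Q t"

lemma h_fun_pq: "h_fun P Q k u t = p t * (P t - fst u * t ^ k) + q t * (Q t - snd u * t ^ k)"
  by (simp add: h_fun_def p_def q_def)

lemma deriv_quotient_power:
  assumes "g holomorphic_on ball 0 r" "t \<in> ball 0 r - {0}"
  shows "((\<lambda>t. g t / t ^ k) has_field_derivative (t * deriv g t - of_nat k * g t) / t ^ Suc k) (at t)"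
proof -
  have "(g has_field_derivative deriv g t) (at t)"
    using assms by (intro holomorphic_derivI[of g "ball 0 r"]) auto
  moreover have "((\<lambda>t. t ^ k) has_field_derivative of_nat k * t ^ (k - 1)) (at t)"
    by (auto intro!: derivative_eq_intros)
  ultimately have "((\<lambda>t. g t / t ^ k) has_field_derivative
      (deriv g t * t ^ k - g t * (of_nat k * t ^ (k - 1))) / (t ^ k * t ^ k)) (at t)"
    using assms by (intro DERIV_divide) auto
  moreover have "(deriv g t * t ^ k - g t * (of_nat k * t ^ (k - 1))) / (t ^ k * t ^ k) =
      (t * deriv g t - of_nat k * g t) / t ^ Suc k"
    using k_pos assms by (cases k) (auto simp: field_simps)
  ultimately show ?thesis by simp
qed

lemma tangent_vector:
  assumes "t \<in> ball 0 r - {0}"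
  shows "(p t, q t) \<in> tangent f (z t)"
proof -
  let ?D = "eval2 (dx f) (z t) * (p t / t ^ Suc k) + eval2 (dy f) (z t) * (q t / t ^ Suc k)"
  have "((\<lambda>t. eval2 f (z t)) has_field_derivative ?D) (at t)"
    unfolding z_def p_def q_def
    by (intro eval2_chain_rule deriv_quotient_power holo assms)
  moreover have "((\<lambda>t. eval2 f (z t)) has_field_derivative 0) (at t)"
    using assms z_on_curve
    by (intro has_field_derivative_transform_within_open[OF DERIV_const[of 0], of "ball 0 r - {0}"]) auto
  ultimately have "?D = 0" by (rule DERIV_unique)
  moreover have "t ^ Suc k \<noteq> 0" using assms by simp
  ultimately show ?thesis
    by (simp add: tangent_def field_simps del: power_Suc)
qed

text \<open>The bridge between geometry and \<open>h\<close>: away from 0, zeros of \<open>h\<close>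
  are the parameters at which \<open>u - z t\<close> is orthogonal to the velocity. The sign appears
  because \<open>h\<close> is built from \<open>z - u\<close>.\<close>

lemma bil_h_fun:
  assumes "t \<noteq> 0"
  shows "h_fun P Q k u t = - (t ^ k * bil (u - z t) (p t, q t))"
  using assms by (simp add: h_fun_pq bil_def z_def field_simps)

lemma tangent_eq:
  assumes "t \<in> ball 0 r - {0}" "z t \<in> curve_reg f" "(p t, q t) \<noteq> (0, 0)" "v \<in> tangent f (z t)"
  shows "\<exists>c. v = (c * p t, c * q t)"
proof -
  define a b where "a = eval2 (dx f) (z t)" and "b = eval2 (dy f) (z t)"
  have ab: "(a, b) \<noteq> (0, 0)" and pq: "a * p t + b * q t = 0" and v: "a * fst v + b * snd v = 0"
    using assms(2,4) tangent_vector[OF assms(1)]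
    by (auto simp: curve_reg_def tangent_def a_def b_def)
  \<comment> \<open>Elimination from the two linear equations: both \<open>a\<close> and
    \<open>b\<close> annihilate the determinant of \<open>v\<close> and \<open>(p t, q t)\<close>,
    and one of them is non-zero.\<close>
  have 1: "a * (fst v * q t - snd v * p t) = q t * (a * fst v + b * snd v) - snd v * (a * p t + b * q t)"
    by (simp add: algebra_simps)
  have 2: "b * (fst v * q t - snd v * p t) = fst v * (a * p t + b * q t) - p t * (a * fst v + b * snd v)"
    by (simp add: algebra_simps)
  have d: "fst v * q t = snd v * p t"
    using 1 2 ab pq v by auto
  show ?thesis
  proof (cases "p t = 0")
    case True
    then show ?thesis using d assms(3) by (intro exI[of _ "snd v / q t"]) (auto simp: prod_eq_iff)
  next
    case False
    then show ?thesis using d by (intro exI[of _ "fst v / p t"]) (auto simp: prod_eq_iff field_simps)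
  qed
qed

lemma tendsto_pq: "p \<midarrow>0\<rightarrow> - of_nat k * P 0" "q \<midarrow>0\<rightarrow> - of_nat k * Q 0"
  unfolding p_def q_def by (auto intro!: tendsto_eq_intros tendsto_PQ)

lemma eventually_pq_nz: "\<forall>\<^sub>F t in at 0. (p t, q t) \<noteq> (0, 0)"
proof -
  have "((\<lambda>t. (p t, q t)) \<longlongrightarrow> (- of_nat k * P 0, - of_nat k * Q 0)) (at 0)"
    by (intro tendsto_Pair tendsto_pq)
  moreover have "(- of_nat k * P 0, - of_nat k * Q 0) \<noteq> (0, 0)"
    using PQ_0 k_pos by auto
  ultimately show ?thesis by (rule tendsto_imp_eventually_ne)
qed

text \<open>Points of the branch correspond to parameters. Conversely, near 0 the point
  \<open>z t\<close> is regular and \<open>(p t, q t)\<close> is non-zero, so this one vector spans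
  the tangent line and a zero of \<open>h\<close> tests all of it.\<close>

lemma atyp_branch_iff:
  "u \<in> atyp_branch f \<xi> \<Gamma> \<longleftrightarrow>
    (\<exists>u' t. u' \<longlonglongrightarrow> u \<and> filterlim t (at 0) sequentially \<and>
       (\<forall>\<^sub>F n in sequentially. h_fun P Q k (u' n) (t n) = 0))"
proof
  assume "u \<in> atyp_branch f \<xi> \<Gamma>"
  then obtain u' x where u': "u' \<longlonglongrightarrow> u"
    and x: "\<And>n. affine_pt (x n) \<in> \<Gamma> - H_inf" "(\<lambda>n. affine_pt (x n)) \<longlonglongrightarrow> \<xi>"
    and bil: "\<And>n v. v \<in> tangent f (x n) \<Longrightarrow> bil (u' n - x n) v = 0"
    unfolding atyp_branch_def by blast
  obtain t where t: "t \<longlonglongrightarrow> 0" "\<forall>\<^sub>F n in sequentially. t n \<in> ball 0 r \<and> \<gamma> (t n) = affine_pt (x n)"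
    using branch_param_sequence[OF param x(2)] x(1) by auto
  have ev: "\<forall>\<^sub>F n in sequentially. t n \<noteq> 0 \<and> h_fun P Q k (u' n) (t n) = 0"
    using t(2)
  proof eventually_elim
    fix n assume n: "t n \<in> ball 0 r \<and> \<gamma> (t n) = affine_pt (x n)"
    \<comment> \<open>The parameter 0 belongs to \<open>\<xi>\<close>, which lies at infinity,
      whereas \<open>x n\<close> is affine.\<close>
    have "t n \<noteq> 0"
      using n \<gamma>_0 \<xi>_H_inf affine_pt_notin_H_inf by metis
    then have "t n \<in> ball 0 r - {0}" "z (t n) = x n" using n \<gamma>_eq[of "t n"] by (auto simp: z_def)
    then show "t n \<noteq> 0 \<and> h_fun P Q k (u' n) (t n) = 0"
      using bil tangent_vector bil_h_fun \<open>t n \<noteq> 0\<close> by (metis mult_zero_right neg_equal_0_iff_equal)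
  qed
  then have "filterlim t (at 0) sequentially"
    using t(1) by (auto simp: filterlim_at elim: eventually_mono)
  moreover have "\<forall>\<^sub>F n in sequentially. h_fun P Q k (u' n) (t n) = 0"
    using ev by eventually_elim blast
  ultimately show "\<exists>u' t. u' \<longlonglongrightarrow> u \<and> filterlim t (at 0) sequentially \<and>
       (\<forall>\<^sub>F n in sequentially. h_fun P Q k (u' n) (t n) = 0)"
    using u' by blast
next
  assume "\<exists>u' t. u' \<longlonglongrightarrow> u \<and> filterlim t (at 0) sequentially \<and>
       (\<forall>\<^sub>F n in sequentially. h_fun P Q k (u' n) (t n) = 0)"
  then obtain u' t where u': "u' \<longlonglongrightarrow> u" and t: "filterlim t (at 0) sequentially"
    and h: "\<forall>\<^sub>F n in sequentially. h_fun P Q k (u' n) (t n) = 0" by blast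
  have "\<forall>\<^sub>F t in at 0. t \<in> ball 0 r - {0} \<and> z t \<in> curve_reg f \<and> (p t, q t) \<noteq> (0, 0)"
    by (intro eventually_conj eventually_punctured eventually_z_regular eventually_pq_nz)
  then have "\<forall>\<^sub>F n in sequentially. t n \<in> ball 0 r - {0} \<and> z (t n) \<in> curve_reg f \<and> (p (t n), q (t n)) \<noteq> (0, 0)"
    using t by (rule eventually_compose_filterlim)
  with h have "\<forall>\<^sub>F n in sequentially. t n \<in> ball 0 r - {0} \<and> z (t n) \<in> curve_reg f \<and>
      (p (t n), q (t n)) \<noteq> (0, 0) \<and> h_fun P Q k (u' n) (t n) = 0"
    by eventually_elim blast
  then obtain N where N: "\<And>n. n \<ge> N \<Longrightarrow> t n \<in> ball 0 r - {0} \<and> z (t n) \<in> curve_reg f \<and>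
      (p (t n), q (t n)) \<noteq> (0, 0) \<and> h_fun P Q k (u' n) (t n) = 0"
    unfolding eventually_sequentially by blast
  \<comment> \<open>\<open>atyp_branch\<close> imposes its conditions on every index, not just
    eventually, so the first \<open>N\<close> terms are dropped.\<close>
  define w x where "w n = u' (n + N)" and "x n = z (t (n + N))" for n
  have "w \<longlonglongrightarrow> u" unfolding w_def using u' by (rule LIMSEQ_ignore_initial_segment)
  moreover have x\<gamma>: "affine_pt (x n) = \<gamma> (t (n + N))" for n
    using N[of "n + N"] \<gamma>_eq[of "t (n + N)"] by (simp add: x_def z_def)
  have "affine_pt (x n) \<in> \<Gamma> - H_inf \<and> x n \<in> curve_reg f" for n
  proof -
    have "\<gamma> (t (n + N)) \<in> \<gamma> ` ball 0 r" using N[of "n + N"] by simp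
    then have "affine_pt (x n) \<in> \<Gamma>" using branch_param_subset[OF param] by (auto simp: x\<gamma>)
    then show ?thesis using N[of "n + N"] affine_pt_notin_H_inf by (simp add: x_def)
  qed
  moreover have "(\<lambda>n. affine_pt (x n)) \<longlonglongrightarrow> \<xi>"
  proof -
    have "(\<lambda>n. t (n + N)) \<longlonglongrightarrow> 0"
      using t by (intro LIMSEQ_ignore_initial_segment) (simp add: filterlim_at)
    then have "(\<lambda>n. \<gamma> (t (n + N))) \<longlonglongrightarrow> \<gamma> 0"
      using N r_pos by (intro continuous_on_tendsto_compose[OF branch_param_continuous[OF param]]) auto
    then show ?thesis by (simp add: x\<gamma> \<gamma>_0)
  qed
  moreover have "bil (w n - x n) v = 0" if "v \<in> tangent f (x n)" for n v
  proof -
    have n: "t (n + N) \<in> ball 0 r - {0}" "z (t (n + N)) \<in> curve_reg f"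
      "(p (t (n + N)), q (t (n + N))) \<noteq> (0, 0)" "h_fun P Q k (u' (n + N)) (t (n + N)) = 0"
      using N[of "n + N"] by auto
    obtain c where c: "v = (c * p (t (n + N)), c * q (t (n + N)))"
      using tangent_eq[OF n(1-3)] \<open>v \<in> tangent f (x n)\<close> unfolding x_def by blast
    have "bil (w n - x n) (p (t (n + N)), q (t (n + N))) = 0"
      using n(1,4) bil_h_fun[of "t (n + N)"] by (simp add: w_def x_def)
    then show ?thesis unfolding c bil_def by (auto simp: algebra_simps) (metis distrib_left mult_zero_right)
  qed
  ultimately show "u \<in> atyp_branch f \<xi> \<Gamma>"
    unfolding atyp_branch_def by blast
qed

end

section \<open>Order of h along a branch\<close>

lemma ord_t_ge_iff: "enat n \<le> ord_t g \<longleftrightarrow> (\<forall>j<n. fps_nth (fps_expansion g 0) j = 0)"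
proof (cases "fps_expansion g 0 = 0")
  case False
  then have "n \<le> subdegree (fps_expansion g 0) \<longleftrightarrow> (\<forall>j<n. fps_nth (fps_expansion g 0) j = 0)"
    by (auto intro: subdegree_geI nth_less_subdegree_zero)
  then show ?thesis using False by (simp add: ord_t_def)
qed (simp add: ord_t_def)

lemma fps_expansion_nth_0: "fps_nth (fps_expansion g z) 0 = g z"
  by (simp add: fps_expansion_def)

lemma fps_expansion_power_times:
  assumes g: "g analytic_on {0}" and f: "\<forall>\<^sub>F t in nhds 0. f t = t ^ m * g t"
  shows "fps_nth (fps_expansion f 0) j = (if j < m then 0 else fps_nth (fps_expansion g 0) (j - m))"
proof -
  obtain S where "open S" "0 \<in> S" "g holomorphic_on S"
    using g by (auto simp: analytic_at)
  then have "g has_fps_expansion fps_expansion g 0" by blast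
  then have "(\<lambda>t. t ^ m * g t) has_fps_expansion fps_X ^ m * fps_expansion g 0"
    by (intro has_fps_expansion_mult has_fps_expansion_fps_X_power)
  then have "f has_fps_expansion fps_X ^ m * fps_expansion g 0"
    using has_fps_expansion_cong[OF f refl] by simp
  then have "fps_expansion f 0 = fps_X ^ m * fps_expansion g 0"
    by (rule fps_expansion_eqI)
  then show ?thesis by (simp add: fps_X_power_mult_nth)
qed

lemma ord_t_power_times:
  assumes "g analytic_on {0}" "\<forall>\<^sub>F t in nhds 0. f t = t ^ m * g t" "g 0 \<noteq> 0"
  shows "ord_t f = enat m"
proof (rule antisym)
  have nth: "fps_nth (fps_expansion f 0) j = (if j < m then 0 else fps_nth (fps_expansion g 0) (j - m))" for j
    using assms by (intro fps_expansion_power_times)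
  show "enat m \<le> ord_t f" by (simp add: ord_t_ge_iff nth)
  have "\<not> enat (Suc m) \<le> ord_t f"
    using assms(3) unfolding ord_t_ge_iff by (auto simp: nth fps_expansion_nth_0 intro!: exI[of _ m])
  then show "ord_t f \<le> enat m" by (cases "ord_t f") auto
qed

text \<open>The order of vanishing, truncated at \<open>k\<close>: any order of at least
  \<open>k\<close>, including that of the zero function, is reported as \<open>m = k\<close> with no
  claim about \<open>g 0\<close>.\<close>

lemma analytic_factor_power:
  assumes A: "A analytic_on {0}" "A 0 = 0"
  obtains m g where "g analytic_on {0}" "\<forall>\<^sub>F t in nhds 0. A t = t ^ m * g t"
    "m = k \<or> m < k \<and> g 0 \<noteq> 0"
proof -
  obtain s where s: "s > 0" "A holomorphic_on ball 0 s"
    using A(1) analytic_at_ball by blast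
  have ev: "\<forall>\<^sub>F t in nhds 0. t \<in> ball 0 s" if "s > 0" for s :: real
    using that by (intro eventually_nhds_in_open) auto
  show ?thesis
  proof (cases "A constant_on ball 0 s")
    case True
    then have "A t = 0" if "t \<in> ball 0 s" for t
      using that A(2) s(1) unfolding constant_on_def by (metis centre_in_ball)
    then have "\<forall>\<^sub>F t in nhds 0. A t = t ^ k * 0"
      by (intro eventually_mono[OF ev[OF s(1)]]) simp
    then show ?thesis by (intro that[of "\<lambda>_. 0" k]) auto
  next
    case False
    then obtain g s' m where g: "0 < s'" "g holomorphic_on ball 0 s'"
      "\<And>w. w \<in> ball 0 s' \<Longrightarrow> A w = w ^ m * g w" "\<And>w. w \<in> ball 0 s' \<Longrightarrow> g w \<noteq> 0"
      using holomorphic_factor_zero_nonconstant[OF s(2), of 0] s(1) A(2) 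
      by (metis open_ball connected_ball centre_in_ball diff_zero)
    have gan: "g analytic_on {0}" using g(1,2) analytic_at_ball by blast
    have gev: "\<forall>\<^sub>F t in nhds 0. A t = t ^ m * g t"
      using ev[OF g(1)] by eventually_elim (rule g(3))
    show ?thesis
    proof (cases "m < k")
      case True
      then show ?thesis using gan gev g(1,4) by (intro that[of g m]) auto
    next
      case False
      have "\<forall>\<^sub>F t in nhds 0. A t = t ^ k * (t ^ (m - k) * g t)"
        using gev by eventually_elim (use False in \<open>simp add: mult.assoc flip: power_add\<close>)
      then show ?thesis using gan
        by (intro that[of "\<lambda>t. t ^ (m - k) * g t" k]) (auto intro!: analytic_intros)
    qed
  qed
qed

text \<open>If \<open>H \<circ> \<phi>\<close> is differentiable, \<open>\<phi>\<close> is continuous and \<open>H\<close> has a non-zero derivative,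
  the difference quotient of \<open>\<phi>\<close> is that of \<open>H \<circ> \<phi>\<close> divided by the slope of \<open>H\<close>.\<close>

lemma DERIV_from_compose:
  fixes H \<phi> :: "complex \<Rightarrow> complex"
  assumes \<phi>: "isCont \<phi> t" and H: "(H has_field_derivative D) (at (\<phi> t))" "D \<noteq> 0"
    and E: "((\<lambda>s. H (\<phi> s)) has_field_derivative E) (at t)"
  shows "(\<phi> has_field_derivative E / D) (at t)"
proof -
  obtain g where g: "\<And>w. H w - H (\<phi> t) = g w * (w - \<phi> t)" "isCont g (\<phi> t)" "g (\<phi> t) = D"
    using H(1) by (auto simp: CARAT_DERIV)
  have lim: "((\<lambda>s. g (\<phi> s)) \<longlongrightarrow> D) (at t)"
    using isCont_o2[OF \<phi> g(2)] g(3) by (simp add: isCont_def)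
  then have nz: "\<forall>\<^sub>F s in at t. g (\<phi> s) \<noteq> 0"
    using H(2) by (rule tendsto_imp_eventually_ne)
  have "((\<lambda>s. (H (\<phi> s) - H (\<phi> t)) / (s - t) / g (\<phi> s)) \<longlongrightarrow> E / D) (at t)"
    using E lim H(2) unfolding has_field_derivative_iff by (intro tendsto_divide)
  moreover have "\<forall>\<^sub>F s in at t. (H (\<phi> s) - H (\<phi> t)) / (s - t) / g (\<phi> s) = (\<phi> s - \<phi> t) / (s - t)"
    using nz by eventually_elim (simp add: g(1))
  ultimately show ?thesis
    unfolding has_field_derivative_iff by (rule Lim_transform_eventually)
qed

context branch_expansion
begin

text \<open>As \<open>k\<close> is positive, the powers of \<open>t\<close> vanish at 0, so that
  h(0, u) is \<open>- k\<close> times the sum of squares for every \<open>u\<close>; as a limit of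
  zeros of \<open>h\<close> it has to be 0.\<close>

lemma atyp_branch_nonempty_isotropic:
  assumes "u \<in> atyp_branch f \<xi> \<Gamma>"
  shows "(P 0)\<^sup>2 + (Q 0)\<^sup>2 = 0"
proof -
  obtain u' t where u': "u' \<longlonglongrightarrow> u" and t: "filterlim t (at 0) sequentially"
    and h: "\<forall>\<^sub>F n in sequentially. h_fun P Q k (u' n) (t n) = 0"
    using assms unfolding atyp_branch_iff by blast
  have t0: "t \<longlonglongrightarrow> 0" using t by (simp add: filterlim_at)
  note lims = tendsto_PQ(1,2)[THEN filterlim_compose, OF t] tendsto_pq[THEN filterlim_compose, OF t]
  have "(\<lambda>n. h_fun P Q k (u' n) (t n)) \<longlonglongrightarrow>
      (- of_nat k * P 0) * (P 0 - fst u * 0 ^ k) + (- of_nat k * Q 0) * (Q 0 - snd u * 0 ^ k)"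
    unfolding h_fun_pq by (intro tendsto_intros lims u' t0)
  moreover have "(\<lambda>n. h_fun P Q k (u' n) (t n)) \<longlonglongrightarrow> 0"
    using h by (rule tendsto_eventually)
  ultimately have "(- of_nat k * P 0) * (P 0 - fst u * 0 ^ k) + (- of_nat k * Q 0) * (Q 0 - snd u * 0 ^ k) = 0"
    by (rule LIMSEQ_unique)
  moreover have "(- of_nat k * P 0) * (P 0 - fst u * 0 ^ k) + (- of_nat k * Q 0) * (Q 0 - snd u * 0 ^ k) =
      - (of_nat k * ((P 0)\<^sup>2 + (Q 0)\<^sup>2))"
    using k_pos by (simp add: zero_power power2_eq_square algebra_simps)
  ultimately have "of_nat k * ((P 0)\<^sup>2 + (Q 0)\<^sup>2) = 0" by simp
  then show ?thesis using k_pos by simp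
qed

text \<open>In the coordinates \<open>x + e y\<close> and \<open>x - e y\<close>, where \<open>e\<^sup>2 = -1\<close>, only the second one has a
  pole of order \<open>k\<close>; the branch contributes a line iff the first one has no pole at all.\<close>

lemma expansion_cases:
  assumes e: "e\<^sup>2 = -1" and e0: "P 0 + e * Q 0 = 0"
  obtains (empty) "atyp_branch f \<xi> \<Gamma> = {}" "\<And>u. \<not> enat (Suc k) \<le> ord_t (h_fun P Q k u)"
  | (line) c where "\<And>u. u \<in> atyp_branch f \<xi> \<Gamma> \<longleftrightarrow> fst u + e * snd u = c"
      "\<And>u. enat (Suc k) \<le> ord_t (h_fun P Q k u) \<longleftrightarrow> fst u + e * snd u = c"
      "\<And>u. h_coeff P Q k k u = 0 \<longleftrightarrow> fst u + e * snd u = c"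
      "((\<lambda>t. (P t + e * Q t) / t ^ k) \<longlongrightarrow> c) (at 0)"
proof -
  define A B where "A t = P t + e * Q t" and "B t = P t - e * Q t" for t
  define a b where "a t = p t + e * q t" and "b t = p t - e * q t" for t
  have e_nz: "e \<noteq> 0" using e by auto
  have Aan: "A analytic_on {0}" unfolding A_def by (intro analytic_intros analytic_PQ)
  have B0: "B 0 \<noteq> 0"
  proof
    assume "B 0 = 0"
    then have "P 0 = 0" "e * Q 0 = 0" using e0 by (auto simp: B_def)
    then show False using PQ_0 e_nz by auto
  qed
  have A0: "A 0 = 0" using e0 by (simp add: A_def)
  obtain m g where gan: "g analytic_on {0}" and A: "\<forall>\<^sub>F t in nhds 0. A t = t ^ m * g t"
    and m: "m = k \<or> m < k \<and> g 0 \<noteq> 0"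
    by (rule analytic_factor_power[OF Aan A0])
  have "m \<le> k" using m by auto
  \<comment> \<open>\<open>G\<close> and \<open>W u\<close> are the cofactors in t A' - k A = t^m G
    and h = t^m W. The exponent \<open>k - m\<close> comes from taking t^m out of the bracket that
    contains \<open>A\<close>.\<close>
  define G where "G t = (of_nat m - of_nat k) * g t + t * deriv g t" for t
  define W where "W u t = (G t * (B t - (fst u - e * snd u) * t ^ k) +
      b t * (g t - (fst u + e * snd u) * t ^ (k - m))) / 2" for u t
  have a: "\<forall>\<^sub>F t in nhds 0. a t = t ^ m * G t"
  proof -
    obtain s where s: "s > 0" "g holomorphic_on ball 0 s" "\<And>t. t \<in> ball 0 s \<Longrightarrow> A t = t ^ m * g t" "s \<le> r"
    proof -
      obtain s1 where s1: "s1 > 0" "g holomorphic_on ball 0 s1"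
        using gan analytic_at_ball by blast
      obtain s2 where s2: "s2 > 0" "\<And>t. t \<in> ball 0 s2 \<Longrightarrow> A t = t ^ m * g t"
        using A unfolding eventually_nhds_metric by (auto simp: dist_commute)
      show ?thesis
        using s1 s2 r_pos by (intro that[of "Min {s1, s2, r}"]) (auto intro: holomorphic_on_subset)
    qed
    have "a t = t ^ m * G t" if t: "t \<in> ball 0 s" for t
    proof -
      have PQd: "(P has_field_derivative deriv P t) (at t)" "(Q has_field_derivative deriv Q t) (at t)"
        using t s(4) by (auto intro!: holomorphic_derivI holo)
      have gd: "(g has_field_derivative deriv g t) (at t)"
        using t s(2) by (auto intro!: holomorphic_derivI)
      have "(A has_field_derivative deriv P t + e * deriv Q t) (at t)"
        unfolding A_def by (auto intro!: derivative_eq_intros PQd)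
      moreover have "((\<lambda>t. t ^ m * g t) has_field_derivative
          of_nat m * t ^ (m - 1) * g t + t ^ m * deriv g t) (at t)"
        by (auto intro!: derivative_eq_intros gd)
      then have "(A has_field_derivative of_nat m * t ^ (m - 1) * g t + t ^ m * deriv g t) (at t)"
        by (rule has_field_derivative_transform_within_open[of _ _ _ "ball 0 s"]) (use t s(3) in auto)
      ultimately have "deriv P t + e * deriv Q t = of_nat m * t ^ (m - 1) * g t + t ^ m * deriv g t"
        by (rule DERIV_unique)
      then have "t * (deriv P t + e * deriv Q t) = t * (of_nat m * t ^ (m - 1) * g t + t ^ m * deriv g t)"
        by simp
      also have "\<dots> = t ^ m * (of_nat m * g t + t * deriv g t)"
        by (cases m) (simp_all add: algebra_simps)
      finally have "a t = t ^ m * (of_nat m * g t + t * deriv g t) - of_nat k * A t"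
        by (simp add: a_def p_def q_def A_def algebra_simps)
      then show ?thesis using s(3)[OF t] by (simp add: G_def algebra_simps)
    qed
    moreover have "\<forall>\<^sub>F t in nhds 0. t \<in> ball 0 s" using s(1) by (intro eventually_nhds_in_open) auto
    ultimately show ?thesis by (auto elim: eventually_mono)
  qed
  have h: "\<forall>\<^sub>F t in nhds 0. \<forall>u. h_fun P Q k u t = t ^ m * W u t"
    using a A
  proof eventually_elim
    fix t assume aA: "a t = t ^ m * G t" "A t = t ^ m * g t"
    show "\<forall>u. h_fun P Q k u t = t ^ m * W u t"
    proof
      fix u :: "complex \<times> complex"
      let ?\<alpha> = "fst u + e * snd u" and ?\<beta> = "fst u - e * snd u"
      have e2: "e * (e * w) = - w" for w
        using e by (metis mult.assoc mult_minus1 power2_eq_square)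
      have "2 * h_fun P Q k u t = a t * (B t - ?\<beta> * t ^ k) + b t * (A t - ?\<alpha> * t ^ k)"
        by (simp add: h_fun_pq a_def b_def A_def B_def algebra_simps e2)
      \<comment> \<open>The split is wanted only next to \<open>?\<alpha>\<close>; the power next to
        \<open>?\<beta>\<close> is split along with it and rejoined below.\<close>
      also have "t ^ k = t ^ m * t ^ (k - m)" using \<open>m \<le> k\<close> by (simp flip: power_add)
      also have "a t * (B t - ?\<beta> * (t ^ m * t ^ (k - m))) + b t * (A t - ?\<alpha> * (t ^ m * t ^ (k - m))) =
          t ^ m * (G t * (B t - ?\<beta> * (t ^ m * t ^ (k - m))) + b t * (g t - ?\<alpha> * t ^ (k - m)))"
        unfolding aA by (simp add: algebra_simps)
      also have "t ^ m * t ^ (k - m) = t ^ k" using \<open>m \<le> k\<close> by (simp flip: power_add)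
      finally show "h_fun P Q k u t = t ^ m * W u t" by (simp add: W_def field_simps)
    qed
  qed
  have g_lim: "g \<midarrow>0\<rightarrow> g 0" "deriv g \<midarrow>0\<rightarrow> deriv g 0"
    using gan by (simp_all add: analytic_at_imp_isCont analytic_deriv flip: isCont_def)
  have G_lim: "G \<midarrow>0\<rightarrow> G 0" unfolding G_def by (intro tendsto_intros g_lim)
  have B_lim: "B \<midarrow>0\<rightarrow> B 0" unfolding B_def by (intro tendsto_intros tendsto_PQ)
  have b0: "b 0 = - of_nat k * B 0" by (simp add: b_def B_def p_def q_def algebra_simps)
  have b_lim: "b \<midarrow>0\<rightarrow> b 0"
    unfolding b_def by (rule tendsto_eq_intros tendsto_pq refl)+ (simp add: p_def q_def)
  have b_nz: "b 0 \<noteq> 0" using B0 k_pos b0 by simp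
  have Wan: "W u analytic_on {0}" for u
    unfolding W_def G_def b_def B_def p_def q_def
    by (intro analytic_intros analytic_PQ gan analytic_deriv) auto
  have W_lim: "(\<lambda>n. W (u' n) (t n)) \<longlonglongrightarrow> W u 0"
    if "u' \<longlonglongrightarrow> u" "filterlim t (at 0) sequentially" for u' u and t :: "nat \<Rightarrow> complex"
  proof -
    have t0: "t \<longlonglongrightarrow> 0" using that(2) by (simp add: filterlim_at)
    show ?thesis unfolding W_def
      by (intro tendsto_intros that(1) t0 G_lim[THEN filterlim_compose, OF that(2)]
        B_lim[THEN filterlim_compose, OF that(2)] b_lim[THEN filterlim_compose, OF that(2)]
        g_lim(1)[THEN filterlim_compose, OF that(2)]) auto
  qed
  \<comment> \<open>Since \<open>t n\<close> is non-zero, zeros of \<open>h\<close> are zeros of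
    \<open>W\<close>, and \<open>W\<close>, unlike \<open>h\<close>, keeps information in the
    limit.\<close>
  have atyp_W: "W u 0 = 0" if "u \<in> atyp_branch f \<xi> \<Gamma>" for u
  proof -
    obtain u' t where u': "u' \<longlonglongrightarrow> u" and t: "filterlim t (at 0) sequentially"
      and h0: "\<forall>\<^sub>F n in sequentially. h_fun P Q k (u' n) (t n) = 0"
      using \<open>u \<in> atyp_branch f \<xi> \<Gamma>\<close> unfolding atyp_branch_iff by blast
    have "\<forall>\<^sub>F t in at 0. t \<noteq> 0 \<and> (\<forall>u. h_fun P Q k u t = t ^ m * W u t)"
      using h by (auto simp: eventually_at_filter elim: eventually_mono)
    then have "\<forall>\<^sub>F n in sequentially. t n \<noteq> 0 \<and> (\<forall>u. h_fun P Q k u (t n) = t n ^ m * W u (t n))"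
      using t by (rule eventually_compose_filterlim)
    with h0 have "\<forall>\<^sub>F n in sequentially. W (u' n) (t n) = 0"
      by eventually_elim auto
    then have "(\<lambda>n. W (u' n) (t n)) \<longlonglongrightarrow> 0" by (rule tendsto_eventually)
    then show ?thesis using W_lim[OF u' t] LIMSEQ_unique by blast
  qed
  have h_ev: "\<forall>\<^sub>F t in nhds 0. h_fun P Q k u t = t ^ m * W u t" for u
    using h by eventually_elim blast
  show ?thesis
  proof (cases "m = k")
    case False
    then have "m < k" "g 0 \<noteq> 0" using m by auto
    \<comment> \<open>The positive power \<open>t ^ (k - m)\<close> removes \<open>u\<close> from
      the value at 0; the contributions \<open>m - k\<close> from \<open>G\<close> and
      \<open>- k\<close> from \<open>b\<close> add up to \<open>m - 2 k\<close>, non-zero because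
      \<open>m < k\<close>.\<close>
    have "2 * W u 0 = (of_nat m - 2 * of_nat k) * g 0 * B 0" for u
      using \<open>m < k\<close> by (simp add: W_def G_def b0 zero_power field_simps)
    moreover have "of_nat m - 2 * of_nat k \<noteq> (0 :: complex)"
    proof
      assume "of_nat m - 2 * of_nat k = (0 :: complex)"
      then have "(of_nat m :: complex) = of_nat (2 * k)" by simp
      then show False using \<open>m < k\<close> unfolding of_nat_eq_iff by simp
    qed
    ultimately have W0: "W u 0 \<noteq> 0" for u
      using \<open>g 0 \<noteq> 0\<close> B0 by (metis mult_eq_0_iff)
    have "ord_t (h_fun P Q k u) = enat m" for u
      using ord_t_power_times[OF Wan h_ev W0] .
    then show ?thesis using \<open>m < k\<close> W0 atyp_W by (intro empty) auto
  next
    case True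
    \<comment> \<open>For \<open>m = k\<close> the value \<open>G 0\<close> is 0 and only the
      product of \<open>b 0\<close> and \<open>g 0 - (fst u + e * snd u)\<close> survives, up to the
      factor 1/2.\<close>
    have W0: "W u 0 = 0 \<longleftrightarrow> fst u + e * snd u = g 0" for u
      using k_pos b_nz by (auto simp: W_def G_def True)
    have nth: "fps_nth (fps_expansion (h_fun P Q k u) 0) j =
        (if j < k then 0 else fps_nth (fps_expansion (W u) 0) (j - k))" for u j
      using fps_expansion_power_times[OF Wan h_ev] True by simp
    have coeff: "h_coeff P Q k k u = W u 0" for u
      by (simp add: h_coeff_def nth fps_expansion_nth_0)
    have ord: "enat (Suc k) \<le> ord_t (h_fun P Q k u) \<longleftrightarrow> W u 0 = 0" for u
      by (auto simp: ord_t_ge_iff nth less_Suc_eq fps_expansion_nth_0)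
    have "u \<in> atyp_branch f \<xi> \<Gamma>" if u: "fst u + e * snd u = g 0" for u
    proof -
      let ?\<beta> = "fst u - e * snd u"
      define t where "t n = complex_of_real (inverse (real (Suc n)))" for n
      \<comment> \<open>With \<open>?\<beta>\<close> held fixed, \<open>W = 0\<close> is a linear
        equation for the other isotropic coordinate. \<open>\<alpha> s\<close> solves it when
        \<open>b s\<close> is non-zero, and tends to \<open>g 0\<close> because
        \<open>G 0 = 0\<close>; \<open>u'\<close> translates back to the standard
        coordinates.\<close>
      define \<alpha> where "\<alpha> s = g s + G s * (B s - ?\<beta> * s ^ k) / b s" for s
      define u' where "u' n = ((\<alpha> (t n) + ?\<beta>) / 2, (\<alpha> (t n) - ?\<beta>) / (2 * e))" for n
      have "t \<longlonglongrightarrow> 0"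
        unfolding t_def using tendsto_of_real[OF LIMSEQ_inverse_real_of_nat, where 'a = complex] by simp
      then have t: "filterlim t (at 0) sequentially"
        by (simp add: filterlim_at t_def del: of_nat_Suc)
      have "(\<alpha> \<longlongrightarrow> g 0 + G 0 * (B 0 - ?\<beta> * 0 ^ k) / b 0) (at 0)"
        unfolding \<alpha>_def by (intro tendsto_intros g_lim G_lim B_lim b_lim b_nz)
      then have "(\<lambda>n. \<alpha> (t n)) \<longlonglongrightarrow> g 0"
        using t by (auto simp: G_def True intro: filterlim_compose)
      then have "u' \<longlonglongrightarrow> ((g 0 + ?\<beta>) / 2, (g 0 - ?\<beta>) / (2 * e))"
        unfolding u'_def using e_nz by (intro tendsto_intros) auto
      also have "((g 0 + ?\<beta>) / 2, (g 0 - ?\<beta>) / (2 * e)) = u"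
        using e_nz u[symmetric] by (simp add: prod_eq_iff)
      finally have "u' \<longlonglongrightarrow> u" .
      moreover have "\<forall>\<^sub>F s in at 0. b s \<noteq> 0 \<and> (\<forall>u. h_fun P Q k u s = s ^ m * W u s)"
        using tendsto_imp_eventually_ne[OF b_lim b_nz] h
        by (auto simp: eventually_at_filter elim: eventually_elim2)
      then have "\<forall>\<^sub>F n in sequentially. b (t n) \<noteq> 0 \<and> (\<forall>u. h_fun P Q k u (t n) = t n ^ m * W u (t n))"
        using t by (rule eventually_compose_filterlim)
      then have "\<forall>\<^sub>F n in sequentially. h_fun P Q k (u' n) (t n) = 0"
      proof eventually_elim
        fix n assume n: "b (t n) \<noteq> 0 \<and> (\<forall>u. h_fun P Q k u (t n) = t n ^ m * W u (t n))"
        have "fst (u' n) + e * snd (u' n) = \<alpha> (t n)" "fst (u' n) - e * snd (u' n) = ?\<beta>"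
          using e_nz by (simp_all add: u'_def field_simps)
        then have "W (u' n) (t n) = (G (t n) * (B (t n) - ?\<beta> * t n ^ k) + b (t n) * (g (t n) - \<alpha> (t n))) / 2"
          by (simp add: W_def True)
        then have "W (u' n) (t n) = 0" using n by (simp add: \<alpha>_def)
        moreover have "h_fun P Q k (u' n) (t n) = t n ^ m * W (u' n) (t n)" using n by blast
        ultimately show "h_fun P Q k (u' n) (t n) = 0" by simp
      qed
      ultimately show ?thesis unfolding atyp_branch_iff using t by blast
    qed
    moreover have "((\<lambda>t. (P t + e * Q t) / t ^ k) \<longlongrightarrow> g 0) (at 0)"
    proof (rule Lim_transform_eventually[OF g_lim(1)])
      show "\<forall>\<^sub>F t in at 0. g t = (P t + e * Q t) / t ^ k"
        using A by (auto simp: eventually_at_filter A_def True elim: eventually_mono)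
    qed
    ultimately show ?thesis
      using atyp_W by (intro line[of "g 0"]) (auto simp: coeff ord W0)
  qed
qed

end

section \<open>Multiplicity at infinity and finiteness\<close>

context branch_expansion
begin

text \<open>The multiplicity does not depend on the parametrization. The transition map
  \<open>\<phi>\<close> from \<open>\<gamma>'\<close> to \<open>\<gamma>\<close> is at first only
  continuous and injective; it is shown to be holomorphic with a simple zero at 0, so substituting
  it into s^k preserves the order \<open>k\<close>.\<close>

lemma ord_lift_nth_3:
  fixes F :: "complex \<Rightarrow> complex ^ 3"
  assumes param': "branch_param \<xi> \<Gamma> \<gamma>' r'"
    and U: "open U" "0 \<in> U" "U \<subseteq> ball 0 r'" and lift: "holomorphic_lift F U \<gamma>'"
  shows "ord_t (\<lambda>t. F t $ 3) = enat k"
proof -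
  let ?v = "\<lambda>s. vector [P s, Q s, s ^ k] :: complex ^ 3"
  obtain \<delta> W where W: "open W" "\<xi> \<in> W" "continuous_on (\<Gamma> \<inter> W) \<delta>"
    and \<delta>: "\<And>x. x \<in> \<Gamma> \<inter> W \<Longrightarrow> \<delta> x \<in> ball 0 r \<and> \<gamma> (\<delta> x) = x"
    "\<And>t. t \<in> ball 0 r \<Longrightarrow> \<gamma> t \<in> \<Gamma> \<inter> W \<and> \<delta> (\<gamma> t) = t"
    using branch_param_inverse[OF param] by metis
  have \<gamma>'_0: "\<gamma>' 0 = \<xi>" using param' by (simp add: branch_param_def)
  define V where "V = U \<inter> \<gamma>' -` W"
  define \<phi> where "\<phi> t = \<delta> (\<gamma>' t)" for t
  have \<gamma>'_cont: "continuous_on U \<gamma>'"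
    using branch_param_continuous[OF param'] U(3) continuous_on_subset by blast
  have V: "open V" "0 \<in> V" "V \<subseteq> U"
    unfolding V_def using U W \<gamma>'_0 \<gamma>'_cont by (auto intro: continuous_open_preimage)
  have \<gamma>'_V: "\<gamma>' t \<in> \<Gamma> \<inter> W" if "t \<in> V" for t
    using that branch_param_subset[OF param'] U(3) by (auto simp: V_def)
  have \<phi>: "\<phi> t \<in> ball 0 r" "\<gamma> (\<phi> t) = \<gamma>' t" if "t \<in> V" for t
    using \<delta>(1)[OF \<gamma>'_V[OF that]] by (simp_all add: \<phi>_def)
  have \<phi>_0: "\<phi> 0 = 0"
    using \<delta>(2)[of 0] r_pos by (simp add: \<phi>_def \<gamma>'_0 \<gamma>_0)
  have \<phi>_cont: "continuous_on V \<phi>"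
    unfolding \<phi>_def using \<gamma>'_V V(3)
    by (intro continuous_on_compose2[OF W(3)] continuous_on_subset[OF \<gamma>'_cont]) auto
  have \<phi>_inj: "inj_on \<phi> V"
  proof (rule inj_onI)
    fix s t assume st: "s \<in> V" "t \<in> V" "\<phi> s = \<phi> t"
    then have "\<gamma>' s = \<gamma>' t" using \<phi>(2) by metis
    then show "s = t"
      using branch_param_inj[OF param'] st V(3) U(3) by (meson inj_onD subsetD)
  qed
  have F: "F t \<noteq> 0" "\<gamma>' t = proj (F t)" if "t \<in> V" for t
    using lift V(3) that unfolding holomorphic_lift_def by auto
  have F_holo: "(\<lambda>t. F t $ j) holomorphic_on V" for j
    using lift V(3) unfolding holomorphic_lift_def by (auto intro: holomorphic_on_subset)
  have minors: "F t $ i * ?v (\<phi> t) $ j = F t $ j * ?v (\<phi> t) $ i" if "t \<in> V" for t i j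
    using that F[OF that] \<phi>[OF that] lift_eq[of "\<phi> t"] lift_nz[of "\<phi> t"] by (intro proj_minors) auto
  \<comment> \<open>One of the first two coordinates of the lift is non-zero at
    \<open>\<xi>\<close>; dividing by it gives an affine chart around \<open>\<xi>\<close>.\<close>
  obtain R i where R: "R 0 \<noteq> 0" "R holomorphic_on ball 0 r" "\<And>s. ?v s $ i = R s"
  proof (cases "P 0 = 0")
    case True
    then show ?thesis using PQ_0 holo(2) that[of Q 2] by simp
  next
    case False
    then show ?thesis using holo(1) that[of P 1] by simp
  qed
  have F3: "F t $ 3 * R (\<phi> t) = F t $ i * \<phi> t ^ k" if "t \<in> V" for t
    using minors[OF that, of 3 i] R(3) by simp
  have Fi: "F 0 $ i \<noteq> 0"
  proof
    assume "F 0 $ i = 0"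
    then have "F 0 $ j = 0" for j
      using minors[OF V(2), of i j] R(1,3) by (simp add: \<phi>_0)
    then show False using F(1)[OF V(2)] by (simp add: vec_eq_iff)
  qed
  \<comment> \<open>The derivative of \<open>s ^ k / R s\<close> is
    \<open>s ^ (k - 1) * N s / (R s)\<^sup>2\<close>, hence non-zero for small
    \<open>s \<noteq> 0\<close>. Thus \<open>\<phi>\<close> inherits differentiability from
    \<open>ratio\<close> away from 0.\<close>
  define N where "N s = of_nat k * R s - s * deriv R s" for s
  have Rc: "R \<midarrow>0\<rightarrow> R 0" "deriv R \<midarrow>0\<rightarrow> deriv R 0"
  proof -
    have "R analytic_on {0}" using R(2) r_pos analytic_at_ball by blast
    then show "R \<midarrow>0\<rightarrow> R 0" "deriv R \<midarrow>0\<rightarrow> deriv R 0"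
      by (simp_all add: analytic_at_imp_isCont analytic_deriv flip: isCont_def)
  qed
  have "N \<midarrow>0\<rightarrow> of_nat k * R 0 - 0 * deriv R 0"
    unfolding N_def by (intro tendsto_intros Rc)
  then have "\<forall>\<^sub>F s in at 0. N s \<noteq> 0"
    by (rule tendsto_imp_eventually_ne) (use k_pos R(1) in auto)
  moreover have "\<forall>\<^sub>F s in at 0. R s \<noteq> 0"
    using Rc(1) R(1) by (rule tendsto_imp_eventually_ne)
  ultimately have "\<forall>\<^sub>F s in at 0. N s \<noteq> 0 \<and> R s \<noteq> 0" by eventually_elim blast
  then obtain \<rho> where \<rho>: "\<rho> > 0" "\<And>s. s \<noteq> 0 \<Longrightarrow> norm s < \<rho> \<Longrightarrow> N s \<noteq> 0 \<and> R s \<noteq> 0"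
    unfolding eventually_at by auto
  have R_nz: "R s \<noteq> 0" if "norm s < \<rho>" for s
    using \<rho>(2)[of s] that R(1) by (cases "s = 0") auto
  have "open (V \<inter> \<phi> -` ball 0 \<rho>)"
    using \<phi>_cont V(1) open_ball by (rule continuous_open_preimage)
  moreover have "open (V \<inter> (\<lambda>t. F t $ i) -` (- {0}))"
    by (rule continuous_open_preimage[OF holomorphic_on_imp_continuous_on[OF F_holo] V(1)]) auto
  ultimately have "open (V \<inter> \<phi> -` ball 0 \<rho> \<inter> (V \<inter> (\<lambda>t. F t $ i) -` (- {0})))"
    by (rule open_Int)
  moreover have "0 \<in> V \<inter> \<phi> -` ball 0 \<rho> \<inter> (V \<inter> (\<lambda>t. F t $ i) -` (- {0}))"
    using V(2) \<phi>_0 \<rho>(1) Fi by simp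
  ultimately obtain \<sigma> where \<sigma>: "\<sigma> > 0"
    "ball 0 \<sigma> \<subseteq> V \<inter> \<phi> -` ball 0 \<rho> \<inter> (V \<inter> (\<lambda>t. F t $ i) -` (- {0}))"
    unfolding open_contains_ball by blast
  have ball: "t \<in> V" "norm (\<phi> t) < \<rho>" "F t $ i \<noteq> 0" if "t \<in> ball 0 \<sigma>" for t
    using \<sigma>(2) that by auto
  have ratio: "F t $ 3 / F t $ i = \<phi> t ^ k / R (\<phi> t)" if "t \<in> ball 0 \<sigma>" for t
    using F3[OF ball(1)[OF that]] ball(3)[OF that] R_nz[OF ball(2)[OF that]]
    by (simp add: field_simps)
  have "\<phi> field_differentiable at t" if t: "t \<in> ball 0 \<sigma> - {0}" for t
  proof -
    let ?s = "\<phi> t"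
    have "?s \<noteq> 0"
      using inj_onD[OF \<phi>_inj, of t 0] \<phi>_0 V(2) ball(1)[of t] t by auto
    then have N: "N ?s \<noteq> 0" and R': "R ?s \<noteq> 0"
      using \<rho>(2) ball(2)[of t] t by auto
    have "(R has_field_derivative deriv R ?s) (at ?s)"
      using \<phi>(1)[OF ball(1)] t by (intro holomorphic_derivI[OF R(2)]) auto
    then have "((\<lambda>s. s ^ k / R s) has_field_derivative
        (of_nat k * ?s ^ (k - 1) * R ?s - ?s ^ k * deriv R ?s) / (R ?s * R ?s)) (at ?s)"
      using R' by (auto intro!: derivative_eq_intros)
    moreover have "of_nat k * ?s ^ (k - 1) * R ?s - ?s ^ k * deriv R ?s = ?s ^ (k - 1) * N ?s"
      using k_pos by (cases k) (auto simp: N_def algebra_simps)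
    then have "(of_nat k * ?s ^ (k - 1) * R ?s - ?s ^ k * deriv R ?s) / (R ?s * R ?s) \<noteq> 0"
      using N R' \<open>?s \<noteq> 0\<close> by simp
    moreover have "(\<lambda>t. F t $ 3 / F t $ i) holomorphic_on ball 0 \<sigma>"
      using ball by (intro holomorphic_intros holomorphic_on_subset[OF F_holo]) auto
    then have "((\<lambda>t. F t $ 3 / F t $ i) has_field_derivative deriv (\<lambda>t. F t $ 3 / F t $ i) t) (at t)"
      using t by (intro holomorphic_derivI) auto
    then have "((\<lambda>t. \<phi> t ^ k / R (\<phi> t)) has_field_derivative deriv (\<lambda>t. F t $ 3 / F t $ i) t) (at t)"
      by (rule has_field_derivative_transform_within_open[of _ _ _ "ball 0 \<sigma>"])
        (use t ratio in auto)
    moreover have "isCont \<phi> t"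
      using \<phi>_cont V(1) ball(1)[of t] t by (simp add: continuous_on_eq_continuous_at)
    ultimately show ?thesis
      using DERIV_from_compose field_differentiable_def by blast
  qed
  then have "\<phi> holomorphic_on (ball 0 \<sigma> - {0})"
    by (simp add: holomorphic_on_def field_differentiable_at_within)
  moreover have "continuous_on (ball 0 \<sigma>) \<phi>"
    using \<phi>_cont ball(1) continuous_on_subset by blast
  \<comment> \<open>The point 0, where that derivative may vanish, is a removable singularity by
    continuity of \<open>\<phi>\<close>; injectivity then makes the derivative of
    \<open>\<phi>\<close> at 0 non-zero.\<close>
  ultimately have \<phi>_holo: "\<phi> holomorphic_on ball 0 \<sigma>"
    by (intro no_isolated_singularity[OF _ _ open_ball, of _ _ _ "{0}"]) simp_all
  have "inj_on \<phi> (ball 0 \<sigma>)" using \<phi>_inj ball(1) inj_on_subset by blast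
  then have "(deriv ^^ 1) \<phi> 0 \<noteq> 0"
    using holomorphic_injective_imp_regular[OF \<phi>_holo] \<sigma>(1) by simp
  from holomorphic_factor_order_of_zero[OF \<phi>_holo open_ball _ zero_less_one this] \<sigma>(1)
  obtain \<eta> \<tau> where \<tau>: "\<tau> > 0" "\<eta> holomorphic_on ball 0 \<tau>"
    "\<And>t. t \<in> ball 0 \<tau> \<Longrightarrow> \<phi> t - \<phi> 0 = (t - 0) ^ 1 * \<eta> t" "\<And>t. t \<in> ball 0 \<tau> \<Longrightarrow> \<eta> t \<noteq> 0"
    by (metis centre_in_ball less_one not_gr_zero)
  define S where "S = ball (0 :: complex) (min \<sigma> \<tau>)"
  define G where "G t = F t $ i * \<eta> t ^ k / R (\<phi> t)" for t
  have S: "open S" "0 \<in> S" "S \<subseteq> ball 0 \<sigma>" "S \<subseteq> ball 0 \<tau>"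
    using \<sigma>(1) \<tau>(1) by (auto simp: S_def)
  have "G holomorphic_on S"
  proof -
    have "\<phi> ` S \<subseteq> ball 0 r" using \<phi>(1) ball(1) S(3) by blast
    then have "(\<lambda>t. R (\<phi> t)) holomorphic_on S"
      using holomorphic_on_compose_gen[OF holomorphic_on_subset[OF \<phi>_holo S(3)] R(2)]
      by (simp add: o_def)
    then show ?thesis
      unfolding G_def using S ball R_nz
      by (intro holomorphic_intros holomorphic_on_subset[OF F_holo] holomorphic_on_subset[OF \<tau>(2)]) auto
  qed
  then have "G analytic_on {0}" using S by (auto simp: analytic_at)
  moreover have "\<forall>\<^sub>F t in nhds 0. F t $ 3 = t ^ k * G t"
  proof (rule eventually_mono[OF eventually_nhds_in_open[OF S(1,2)]])
    fix t assume "t \<in> S"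
    then have t: "t \<in> ball 0 \<sigma>" "t \<in> ball 0 \<tau>" using S by auto
    have "F t $ 3 = F t $ i * (\<phi> t ^ k / R (\<phi> t))"
      using ratio[OF t(1)] ball(3)[OF t(1)] by (simp add: field_simps)
    also have "\<phi> t = t * \<eta> t" using \<tau>(3)[OF t(2)] by (simp add: \<phi>_0)
    finally show "F t $ 3 = t ^ k * G t"
      using \<tau>(3)[OF t(2)] by (simp add: G_def \<phi>_0 power_mult_distrib)
  qed
  moreover have "G 0 \<noteq> 0" using Fi R(1) \<tau>(1,4) by (simp add: G_def \<phi>_0)
  ultimately show ?thesis by (rule ord_t_power_times)
qed

text \<open>All parametrizations and lifts give the order \<open>k\<close>, and the lift read off
  from the expansion shows that one exists, so the description in \<open>mult_inf\<close> is
  proper.\<close>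

lemma mult_inf_eq: "mult_inf \<xi> \<Gamma> = enat k"
  unfolding mult_inf_def
proof (rule the_equality)
  let ?F = "\<lambda>t. vector [P t, Q t, t ^ k] :: complex ^ 3"
  have "\<forall>i. (\<lambda>t. ?F t $ i) holomorphic_on ball 0 r"
    using holo by (auto simp: forall_3 intro!: holomorphic_intros)
  then have "holomorphic_lift ?F (ball 0 r) \<gamma>"
    using lift_nz lift_eq by (simp add: holomorphic_lift_def)
  then show "\<exists>\<gamma> r F U. branch_param \<xi> \<Gamma> \<gamma> r \<and> open U \<and> 0 \<in> U \<and> U \<subseteq> ball 0 r \<and>
      holomorphic_lift F U \<gamma> \<and> enat k = ord_t (\<lambda>t. F t $ 3)"
    using param r_pos ord_lift_nth_3[OF param, of "ball 0 r" ?F]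
    by (intro exI[of _ \<gamma>] exI[of _ r] exI[of _ ?F] exI[of _ "ball 0 r"]) simp
next
  fix m
  assume "\<exists>\<gamma> r F U. branch_param \<xi> \<Gamma> \<gamma> r \<and> open U \<and> 0 \<in> U \<and> U \<subseteq> ball 0 r \<and>
      holomorphic_lift F U \<gamma> \<and> m = ord_t (\<lambda>t. F t $ 3)"
  then show "m = enat k" using ord_lift_nth_3 by blast
qed

lemma isotropic_slope:
  assumes "(P 0)\<^sup>2 + (Q 0)\<^sup>2 = 0"
  obtains e where "e \<in> {\<i>, -\<i>}" "e\<^sup>2 = -1" "P 0 + e * Q 0 = 0"
proof -
  have "(P 0 + \<i> * Q 0) * (P 0 + (-\<i>) * Q 0) = (P 0)\<^sup>2 + (Q 0)\<^sup>2"
    by (simp add: power2_eq_square algebra_simps)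
  then have "P 0 + \<i> * Q 0 = 0 \<or> P 0 + (-\<i>) * Q 0 = 0"
    using assms by (metis mult_eq_0_iff)
  then show ?thesis
  proof
    assume "P 0 + \<i> * Q 0 = 0"
    then show ?thesis by (intro that[of \<i>]) auto
  next
    assume "P 0 + (-\<i>) * Q 0 = 0"
    then show ?thesis by (intro that[of "-\<i>"]) auto
  qed
qed

lemma isotropic_branch:
  assumes "\<xi> \<in> Q_inf"
  shows "u \<in> atyp_branch f \<xi> \<Gamma> \<longleftrightarrow> 1 + mult_inf \<xi> \<Gamma> \<le> ord_t (h_fun P Q k u)"
    and "atyp_branch f \<xi> \<Gamma> \<noteq> {} \<Longrightarrow>
      is_line (atyp_branch f \<xi> \<Gamma>) \<and> atyp_branch f \<xi> \<Gamma> = {u. h_coeff P Q k k u = 0}"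
proof -
  have "(P 0)\<^sup>2 + (Q 0)\<^sup>2 = 0"
    using assms PQ_0 unfolding \<xi>_eq by (rule proj_Q_inf)
  then obtain e where e: "e\<^sup>2 = -1" "P 0 + e * Q 0 = 0"
    using isotropic_slope by metis
  have mult: "1 + mult_inf \<xi> \<Gamma> = enat (Suc k)"
    by (simp add: mult_inf_eq one_enat_def)
  show "u \<in> atyp_branch f \<xi> \<Gamma> \<longleftrightarrow> 1 + mult_inf \<xi> \<Gamma> \<le> ord_t (h_fun P Q k u)"
    using e by (cases rule: expansion_cases) (auto simp: mult)
  show "is_line (atyp_branch f \<xi> \<Gamma>) \<and> atyp_branch f \<xi> \<Gamma> = {u. h_coeff P Q k k u = 0}"
    if ne: "atyp_branch f \<xi> \<Gamma> \<noteq> {}"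
    using e
  proof (cases rule: expansion_cases)
    case empty
    then show ?thesis using ne by blast
  next
    case (line c)
    have "atyp_branch f \<xi> \<Gamma> = {u. fst u + e * snd u = c}" using line(1) by blast
    then show ?thesis
      using isotropic_line_slope[OF e(1), of c] line(3) by (auto simp: isotropic_line_def)
  qed
qed

end

text \<open>The union \<open>atyp\<close> provides branches without expansions. A third coordinate
  \<open>t ^ k * g t\<close> with \<open>g\<close> free of zeros yields one after division of the
  lift by \<open>g\<close>, on a possibly smaller disk.\<close>

lemma branch_affine_expansion:
  assumes bp: "branch_param \<xi> \<Gamma> \<gamma> r" and \<xi>: "\<xi> \<in> H_inf" and ne: "atyp_branch f \<xi> \<Gamma> \<noteq> {}"
  obtains s P Q k where "branch_param \<xi> \<Gamma> \<gamma> s" "affine_expansion \<gamma> s P Q k"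
proof -
  have r: "r > 0" "\<gamma> 0 = \<xi>" using bp by (auto simp: branch_param_def)
  obtain x where x: "\<And>n. affine_pt (x n) \<in> \<Gamma> - H_inf" "(\<lambda>n. affine_pt (x n)) \<longlonglongrightarrow> \<xi>"
    using ne unfolding atyp_branch_def by blast
  obtain t where t: "t \<longlonglongrightarrow> 0" "\<forall>\<^sub>F n in sequentially. t n \<in> ball 0 r \<and> \<gamma> (t n) = affine_pt (x n)"
    using branch_param_sequence[OF bp x(2)] x(1) by auto
  obtain U F where U: "open U" "0 \<in> U" "U \<subseteq> ball 0 r" and lift: "holomorphic_lift F U \<gamma>"
    using bp r(1) unfolding branch_param_def holomorphic_P2_def by (metis centre_in_ball)
  obtain d where d: "d > 0" "ball 0 d \<subseteq> U" using U(1,2) open_contains_ball by blast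
  have F: "F t \<noteq> 0" "\<gamma> t = proj (F t)" if "t \<in> ball 0 d" for t
    using lift d(2) that unfolding holomorphic_lift_def by auto
  have F_holo: "(\<lambda>t. F t $ j) holomorphic_on ball 0 d" for j
    using lift d(2) unfolding holomorphic_lift_def by (auto intro: holomorphic_on_subset)
  have F3_0: "F 0 $ 3 = 0"
    using \<xi> F[of 0] d(1) r(2) proj_in_H_inf_iff by simp
  \<comment> \<open>A branch inside the line at infinity is excluded, since the non-empty atypical
    set supplies affine points of \<open>\<Gamma>\<close> arbitrarily close to
    \<open>\<xi>\<close>.\<close>
  have nonconst: "\<not> (\<lambda>t. F t $ 3) constant_on ball 0 d"
  proof
    assume "(\<lambda>t. F t $ 3) constant_on ball 0 d"
    then have F3: "F t $ 3 = 0" if "t \<in> ball 0 d" for t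
      using that F3_0 d(1) unfolding constant_on_def by (metis centre_in_ball)
    have "\<forall>\<^sub>F n in sequentially. t n \<in> ball 0 d"
      using topological_tendstoD[OF t(1) open_ball, of 0 d] d(1) by simp
    with t(2) have "\<forall>\<^sub>F n in sequentially. False"
    proof eventually_elim
      fix n assume n: "t n \<in> ball 0 r \<and> \<gamma> (t n) = affine_pt (x n)" "t n \<in> ball 0 d"
      have "proj (F (t n)) \<in> H_inf"
        using F(1)[OF n(2)] F3[OF n(2)] proj_in_H_inf_iff by blast
      then show False using n(1) F(2)[OF n(2)] affine_pt_notin_H_inf by metis
    qed
    then show False by simp
  qed
  obtain g s k where g: "0 < k" "0 < s" "ball 0 s \<subseteq> ball (0 :: complex) d" "g holomorphic_on ball 0 s"
    "\<And>w. w \<in> ball 0 s \<Longrightarrow> F w $ 3 = (w - 0) ^ k * g w" "\<And>w. w \<in> ball 0 s \<Longrightarrow> g w \<noteq> 0"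
    by (rule holomorphic_factor_zero_nonconstant[OF F_holo[of 3] open_ball connected_ball
      centre_in_ball[THEN iffD2, OF d(1)] F3_0 nonconst]) (rule that)
  have "ball 0 s \<subseteq> ball (0 :: complex) r" using g(3) d(2) U(3) by (meson order_trans)
  then have "s \<le> r" using g(2) by (simp add: ball_subset_ball_iff)
  have "affine_expansion \<gamma> s (\<lambda>t. F t $ 1 / g t) (\<lambda>t. F t $ 2 / g t) k"
    unfolding affine_expansion_def
  proof (intro conjI ballI)
    show "(\<lambda>t. F t $ 1 / g t) holomorphic_on ball 0 s" "(\<lambda>t. F t $ 2 / g t) holomorphic_on ball 0 s"
      using g by (auto intro!: holomorphic_intros holomorphic_on_subset[OF F_holo])
    show "(F 0 $ 1 / g 0, F 0 $ 2 / g 0) \<noteq> (0, 0)"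
      using F(1)[of 0] d(1) F3_0 g(2) g(6)[of 0] by (auto simp: vec_eq_iff forall_3)
    show "1 \<le> k" using g(1) by simp
    fix t :: complex
    assume t: "t \<in> ball 0 s - {0}"
    then have "F t $ 3 \<noteq> 0" using g(5,6)[of t] by simp
    then show "\<gamma> t = affine_pt (F t $ 1 / g t / t ^ k, F t $ 2 / g t / t ^ k)"
      using proj_eq_affine_pt[of "F t"] F(2)[of t] g(3) g(5)[of t] t by (auto simp: mult.commute)
  qed
  then show ?thesis using branch_param_shrink[OF bp g(2) \<open>s \<le> r\<close>] that by blast
qed

section \<open>Finiteness of the set of atypical lines\<close>

text \<open>The substitution \<open>x = a - e y\<close> makes \<open>a = x + e y\<close> a coordinate; along a sequence with
  \<open>y \<rightarrow> \<infinity>\<close> and \<open>a \<rightarrow> c\<close> the leading coefficient in \<open>y\<close> has to vanish at \<open>c\<close>.\<close>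

lemma shear_polynomial: "\<exists>g. \<forall>a y. eval2 g (a, y) = eval2 f (a - e * y, y)"
proof (induction f)
  case (pCons c f)
  then obtain g where g: "\<And>a y. eval2 g (a, y) = eval2 f (a - e * y, y)" by blast
  have "\<exists>h. \<forall>a y. eval2 h (a, y) = poly c (a - e * y)"
  proof (induction c)
    case (pCons b c)
    then obtain h where h: "\<And>a y. eval2 h (a, y) = poly c (a - e * y)" by blast
    have "eval2 ([:[:b:]:] + [:[:0, 1:], [:-e:]:] * h) (a, y) = poly (pCons b c) (a - e * y)" for a y
      by (simp add: h algebra_simps)
    then show ?case by blast
  qed (auto intro: exI[of _ 0])
  then obtain h where h: "\<And>a y. eval2 h (a, y) = poly c (a - e * y)" by blast
  have "eval2 (h + pCons 0 g) (a, y) = eval2 (pCons c f) (a - e * y, y)" for a y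
    by (simp add: g h)
  then show ?case by blast
qed (auto intro: exI[of _ 0])

lemma eval2_nonzero:
  assumes "f \<noteq> 0"
  obtains p where "eval2 f p \<noteq> 0"
proof -
  obtain n where "coeff f n \<noteq> 0" using assms by (auto simp: poly_eq_iff)
  then obtain c where "poly (coeff f n) c \<noteq> 0" using poly_all_0_iff_0 by blast
  then have "map_poly (\<lambda>p. poly p c) f \<noteq> 0" by (metis coeff_0 coeff_map_poly poly_0)
  then obtain y where "poly (map_poly (\<lambda>p. poly p c) f) y \<noteq> 0" using poly_all_0_iff_0 by blast
  then show ?thesis using that by (simp add: poly_map_poly_eval)
qed

text \<open>After division by \<open>y ^ N\<close> all terms but the leading one carry a positive
  power of 1/y and disappear in the limit.\<close>

lemma lead_coeff_limit:
  assumes "g \<noteq> 0" and F: "F \<noteq> bot" and a: "(a \<longlongrightarrow> c) F" and y: "filterlim y at_infinity F"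
    and zero: "\<forall>\<^sub>F n in F. eval2 g (a n, y n) = 0"
  shows "poly (lead_coeff g) c = 0"
proof -
  define N where "N = degree g"
  have inv: "((\<lambda>n. inverse (y n)) \<longlongrightarrow> 0) F"
    using y by (rule filterlim_compose[OF tendsto_inverse_0])
  have eval: "eval2 g (a n, y n) = (\<Sum>j\<le>N. poly (coeff g j) (a n) * y n ^ j)" for n
    by (simp add: eval2_def poly_altdef[of g] poly_sum N_def)
  have "((\<lambda>n. \<Sum>j\<le>N. poly (coeff g j) (a n) * inverse (y n) ^ (N - j)) \<longlongrightarrow>
      (\<Sum>j\<le>N. poly (coeff g j) c * 0 ^ (N - j))) F"
    by (intro tendsto_intros tendsto_poly a inv)
  moreover have "(\<Sum>j\<le>N. poly (coeff g j) c * 0 ^ (N - j)) = (\<Sum>j\<in>{N}. poly (coeff g j) c)"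
    by (intro sum.mono_neutral_cong_right) (auto simp: zero_power)
  moreover have "\<forall>\<^sub>F n in F. (\<Sum>j\<le>N. poly (coeff g j) (a n) * inverse (y n) ^ (N - j)) = 0"
  proof -
    have "\<forall>\<^sub>F n in F. y n \<noteq> 0"
      using y by (auto simp: filterlim_at_infinity_conv_norm_at_top filterlim_at_top_dense
        elim!: allE[of _ 0] eventually_mono)
    with zero show ?thesis
    proof eventually_elim
      fix n assume n: "eval2 g (a n, y n) = 0" "y n \<noteq> 0"
      have "(\<Sum>j\<le>N. poly (coeff g j) (a n) * inverse (y n) ^ (N - j)) =
          (\<Sum>j\<le>N. poly (coeff g j) (a n) * y n ^ j * inverse (y n) ^ N)"
        using n(2) by (intro sum.cong) (auto simp: power_diff field_simps)
      also have "\<dots> = eval2 g (a n, y n) * inverse (y n) ^ N"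
        by (simp add: eval sum_distrib_right)
      finally show "(\<Sum>j\<le>N. poly (coeff g j) (a n) * inverse (y n) ^ (N - j)) = 0" using n by simp
    qed
  qed
  then have "((\<lambda>n. \<Sum>j\<le>N. poly (coeff g j) (a n) * inverse (y n) ^ (N - j)) \<longlongrightarrow> 0) F"
    by (rule tendsto_eventually)
  ultimately show ?thesis using F tendsto_unique by (fastforce simp: N_def)
qed

text \<open>The order of quantifiers is the point: one finite set \<open>S\<close> serves all paths
  \<open>x\<close>, \<open>y\<close>, hence all branches at once.\<close>

lemma finite_asymptotic_values:
  assumes "f \<noteq> 0" "F \<noteq> bot"
  shows "\<exists>S. finite S \<and> (\<forall>x y c. ((\<lambda>n. x n + e * y n) \<longlongrightarrow> c) F \<longrightarrow> filterlim y at_infinity F \<longrightarrow>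
    (\<forall>\<^sub>F n in F. eval2 f (x n, y n) = 0) \<longrightarrow> c \<in> S)"
proof -
  obtain g where g: "\<And>a y. eval2 g (a, y) = eval2 f (a - e * y, y)"
    using shear_polynomial[of f e] by blast
  obtain p where "eval2 f p \<noteq> 0" using assms(1) by (rule eval2_nonzero)
  then have "eval2 g (fst p + e * snd p, snd p) \<noteq> 0" by (simp add: g)
  then have "g \<noteq> 0" by auto
  show ?thesis
  proof (intro exI[of _ "{c. poly (lead_coeff g) c = 0}"] conjI allI impI)
    show "finite {c. poly (lead_coeff g) c = 0}"
      using \<open>g \<noteq> 0\<close> by (simp add: poly_roots_finite)
    fix x y c
    assume *: "((\<lambda>n. x n + e * y n) \<longlongrightarrow> c) F" "filterlim y at_infinity F"
      "\<forall>\<^sub>F n in F. eval2 f (x n, y n) = 0"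
    then show "c \<in> {c. poly (lead_coeff g) c = 0}"
      using lead_coeff_limit[OF \<open>g \<noteq> 0\<close> assms(2) *(1-2)] by (simp add: g)
  qed
qed

text \<open>States the branch analysis in terms of a path on the curve alone, the form to which
  \<open>finite_asymptotic_values\<close> applies.\<close>

lemma atyp_branch_line:
  assumes f: "reduced_curve f" and \<xi>: "\<xi> \<in> X_inf f" and \<Gamma>: "is_branch f \<xi> \<Gamma>"
    and ne: "atyp_branch f \<xi> \<Gamma> \<noteq> {}"
  obtains e c x y where "e \<in> {\<i>, -\<i>}" "atyp_branch f \<xi> \<Gamma> = {u. fst u + e * snd u = c}"
    "((\<lambda>t :: complex. x t + e * y t) \<longlongrightarrow> c) (at 0)" "filterlim y at_infinity (at 0)"
    "\<forall>\<^sub>F t in at 0. eval2 f (x t, y t) = 0"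
proof -
  obtain \<gamma> r where sub: "\<Gamma> \<subseteq> proj_closure (curve f)" and "branch_param \<xi> \<Gamma> \<gamma> r"
    using \<Gamma> unfolding is_branch_def by blast
  moreover have "\<xi> \<in> H_inf" using \<xi> by (simp add: X_inf_def)
  ultimately obtain s P Q k where bp: "branch_param \<xi> \<Gamma> \<gamma> s" and ae: "affine_expansion \<gamma> s P Q k"
    using branch_affine_expansion[OF _ _ ne] by blast
  interpret branch_expansion f \<xi> \<Gamma> \<gamma> s P Q k
    by (rule branch_expansion.intro[OF f sub bp ae])
  obtain e where e: "e \<in> {\<i>, -\<i>}" "e\<^sup>2 = -1" "P 0 + e * Q 0 = 0"
    using isotropic_slope atyp_branch_nonempty_isotropic ne by blast
  from e(2,3) show ?thesis
  proof (cases rule: expansion_cases)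
    case empty
    then show ?thesis using ne by blast
  next
    case (line c)
    \<comment> \<open>If \<open>Q 0\<close> were 0, then \<open>P 0 = - e * Q 0\<close> would be 0
      as well. So y really has a pole at 0.\<close>
    have "Q 0 \<noteq> 0" using PQ_0 e(3) by auto
    then have "filterlim (\<lambda>t. Q t / t ^ k) at_infinity (at 0)"
      using tendsto_PQ(2) k_pos
      by (intro filterlim_divide_at_infinity) (auto simp: filterlim_at eventually_at_filter intro!: tendsto_eq_intros)
    moreover have "((\<lambda>t. P t / t ^ k + e * (Q t / t ^ k)) \<longlongrightarrow> c) (at 0)"
      using line(4) by (simp add: add_divide_distrib)
    moreover have "\<forall>\<^sub>F t in at 0. eval2 f (P t / t ^ k, Q t / t ^ k) = 0"
      using eventually_punctured by eventually_elim (use z_on_curve in \<open>simp add: z_def\<close>)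
    ultimately show ?thesis
      using line(1) e(1) by (intro that[of e c "\<lambda>t. P t / t ^ k" "\<lambda>t. Q t / t ^ k"]) auto
  qed
qed

lemma atyp_finite_union:
  assumes f: "reduced_curve f"
  shows "\<exists>\<L>. finite \<L> \<and> (\<forall>L\<in>\<L>. isotropic_line L) \<and> atyp f = \<Union>\<L>"
proof -
  have "f \<noteq> 0" using f by (auto simp: reduced_curve_def)
  have "\<forall>e. \<exists>S. finite S \<and> (\<forall>x y c. ((\<lambda>t :: complex. x t + e * y t) \<longlongrightarrow> c) (at 0) \<longrightarrow>
      filterlim y at_infinity (at 0) \<longrightarrow> (\<forall>\<^sub>F t in at 0. eval2 f (x t, y t) = 0) \<longrightarrow> c \<in> S)"
    using finite_asymptotic_values[OF \<open>f \<noteq> 0\<close> at_neq_bot] by blast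
  from choice[OF this] obtain S where S: "\<And>e. finite (S e)"
    "\<And>e x y c. ((\<lambda>t :: complex. x t + e * y t) \<longlongrightarrow> c) (at 0) \<Longrightarrow>
      filterlim y at_infinity (at 0) \<Longrightarrow> (\<forall>\<^sub>F t in at 0. eval2 f (x t, y t) = 0) \<Longrightarrow> c \<in> S e"
    by blast
  \<comment> \<open>Empty sets are left out because they are not lines. Infinitely many sets
    \<open>\<Gamma>\<close> may represent one germ, so finiteness comes from the values
    \<open>c\<close>, not from a count of branches.\<close>
  define \<L> where "\<L> = {L. L \<noteq> {} \<and> (\<exists>\<xi> \<Gamma>. \<xi> \<in> X_inf f \<and> is_branch f \<xi> \<Gamma> \<and> L = atyp_branch f \<xi> \<Gamma>)}"
  have L: "\<exists>e\<in>{\<i>, -\<i>}. \<exists>c\<in>S e. L = {u. fst u + e * snd u = c}" if "L \<in> \<L>" for L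
  proof -
    obtain \<xi> \<Gamma> where "\<xi> \<in> X_inf f" "is_branch f \<xi> \<Gamma>" and eq: "L = atyp_branch f \<xi> \<Gamma>"
      and ne: "atyp_branch f \<xi> \<Gamma> \<noteq> {}"
      using \<open>L \<in> \<L>\<close> unfolding \<L>_def by blast
    then obtain e c x y where "e \<in> {\<i>, -\<i>}" "atyp_branch f \<xi> \<Gamma> = {u. fst u + e * snd u = c}"
      "((\<lambda>t :: complex. x t + e * y t) \<longlongrightarrow> c) (at 0)" "filterlim y at_infinity (at 0)"
      "\<forall>\<^sub>F t in at 0. eval2 f (x t, y t) = 0"
      using atyp_branch_line[OF f _ _ ne] by blast
    then show ?thesis using S(2)[of x e y c] eq by blast
  qed
  have "\<L> \<subseteq> (\<Union>e\<in>{\<i>, -\<i>}. (\<lambda>c. {u. fst u + e * snd u = c}) ` S e)"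
    using L by blast
  then have "finite \<L>" by (rule finite_subset) (simp add: S(1))
  moreover have "isotropic_line L" if L\<L>: "L \<in> \<L>" for L
  proof -
    obtain e c where "e \<in> {\<i>, -\<i>}" "L = {u. fst u + e * snd u = c}" using L[OF L\<L>] by blast
    then show ?thesis using isotropic_line_slope[of e c] by auto
  qed
  moreover have "atyp f = \<Union>\<L>" unfolding atyp_def \<L>_def by blast
  ultimately show ?thesis by blast
qed

theorem theorem3p4:
  fixes f :: "complex poly poly"
  assumes "reduced_curve f"
  shows "(\<forall>\<xi> \<Gamma> \<gamma> r P Q k.
            \<xi> \<in> X_inf f \<inter> Q_inf \<longrightarrow> is_branch f \<xi> \<Gamma> \<longrightarrow>
            branch_param \<xi> \<Gamma> \<gamma> r \<longrightarrow> affine_expansion \<gamma> r P Q k \<longrightarrow>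
            (\<forall>u. u \<in> atyp_branch f \<xi> \<Gamma> \<longleftrightarrow> ord_t (h_fun P Q k u) \<ge> 1 + mult_inf \<xi> \<Gamma>) \<and>
            (atyp_branch f \<xi> \<Gamma> \<noteq> {} \<longrightarrow>
               is_line (atyp_branch f \<xi> \<Gamma>) \<and>
               atyp_branch f \<xi> \<Gamma> = {u. h_coeff P Q k k u = 0})) \<and>
         (\<exists>\<L>. finite \<L> \<and> (\<forall>L\<in>\<L>. isotropic_line L) \<and> atyp f = \<Union>\<L>)"
proof (intro conjI allI impI)
  fix \<xi> \<Gamma> \<gamma> r P Q k
  assume *: "\<xi> \<in> X_inf f \<inter> Q_inf" "is_branch f \<xi> \<Gamma>" "branch_param \<xi> \<Gamma> \<gamma> r" "affine_expansion \<gamma> r P Q k"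
  have sub: "\<Gamma> \<subseteq> proj_closure (curve f)" using *(2) by (simp add: is_branch_def)
  interpret branch_expansion f \<xi> \<Gamma> \<gamma> r P Q k
    by (rule branch_expansion.intro[OF assms sub *(3,4)])
  have Q: "\<xi> \<in> Q_inf" using *(1) by blast
  show "u \<in> atyp_branch f \<xi> \<Gamma> \<longleftrightarrow> ord_t (h_fun P Q k u) \<ge> 1 + mult_inf \<xi> \<Gamma>" for u
    by (rule isotropic_branch(1)[OF Q])
  assume "atyp_branch f \<xi> \<Gamma> \<noteq> {}"
  from isotropic_branch(2)[OF Q this]
  show "is_line (atyp_branch f \<xi> \<Gamma>)" "atyp_branch f \<xi> \<Gamma> = {u. h_coeff P Q k k u = 0}"
    by blast+
next
  show "\<exists>\<L>. finite \<L> \<and> (\<forall>L\<in>\<L>. isotropic_line L) \<and> atyp f = \<Union>\<L>"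
    using assms by (rule atyp_finite_union)
qed

end
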